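(* Let $N\ge 2$, let $\Omega\subset\mathbb{R}^N$ be a bounded open set, and let $A:\Omega\to\mathbb{R}^{N\times N}$ be a measurable matrix field for which there exist $\alpha,\beta>0$ with $A(x)\xi\cdot\xi\ge\alpha|\xi|^2$ and $|A(x)|\le\beta$ for almost every $x\in\Omega$ and every $\xi\in\mathbb{R}^N$. Let $0\le f\in L^1(\Omega)$. Let $h:[0,\infty)\to[0,\infty]$ be continuous, finite outside the origin, with $h(0)\neq 0$, such that there exist $\gamma\ge0$ and $c_1,s_1>0$ with $h(s)\le c_1s^{-\gamma}$ for $s<s_1$, and such that $\limsup_{s\to\infty}h(s)<\infty$. Assume that $h$ is non-increasing. Then there is at most one weak solution (i.e. distributional solution belonging to $H^1_0(\Omega)$) of $$-\operatorname{div}(A(x)\nabla u)=h(u)f\ \text{ in }\Omega,\qquad u=0\ \text{ on }\partial\Omega.$$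
   Context: For $k>0$, $T_k(s)=\max(-k,\min(s,k))$ and $T_k^a(u)$ means $(T_k(u))^a$. Set $\sigma=\max(1,\gamma)$. $C^1_c(\Omega)$ denotes the $C^1$ functions with compact support in $\Omega$. The product $h(u)f$ is understood to be $0$ at points where $f=0$. A nonnegative function $u\in W^{1,1}_{\rm loc}(\Omega)$ is a distributional solution of the problem if $h(u)f\in L^1_{\rm loc}(\Omega)$, $T_k^{\frac{\sigma+1}{2}}(u)\in W^{1,1}_0(\Omega)$ for every $k>0$, and $$\int_\Omega A(x)\nabla u\cdot\nabla\varphi=\int_\Omega h(u)f\varphi\qquad\text{for all }\varphi\in C^1_c(\Omega).$$ A weak solution is a distributional solution that belongs to $H^1_0(\Omega)$. *)

theory Defs
  imports "HOL-Analysis.Analysis"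
begin

definition classical_gradient :: "(real ^ 'n \<Rightarrow> real) \<Rightarrow> real ^ 'n \<Rightarrow> real ^ 'n" where
  "classical_gradient \<phi> x = (\<chi> i. frechet_derivative \<phi> (at x) (axis i 1))"

text \<open>Functions with compact support in the open set \<open>\<Omega>\<close> are identified with their extensions
  by zero to the whole space.\<close>

definition C1c :: "(real ^ 'n) set \<Rightarrow> (real ^ 'n \<Rightarrow> real) set" where
  "C1c \<Omega> = {\<phi>. (\<forall>x. \<phi> differentiable (at x)) \<and> continuous_on UNIV (classical_gradient \<phi>) \<and>
     compact (closure {x. \<phi> x \<noteq> 0}) \<and> closure {x. \<phi> x \<noteq> 0} \<subseteq> \<Omega>}"

definition L1_loc :: "(real ^ 'n) set \<Rightarrow> (real ^ 'n \<Rightarrow> 'b::euclidean_space) set" where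
  "L1_loc \<Omega> = {u. \<forall>K. compact K \<longrightarrow> K \<subseteq> \<Omega> \<longrightarrow> u absolutely_integrable_on K}"

definition L1_loc_ennreal :: "(real ^ 'n) set \<Rightarrow> (real ^ 'n \<Rightarrow> ennreal) set" where
  "L1_loc_ennreal \<Omega> = {w \<in> borel_measurable (lebesgue_on \<Omega>).
     \<forall>K. compact K \<longrightarrow> K \<subseteq> \<Omega> \<longrightarrow> (\<integral>\<^sup>+x\<in>K. w x \<partial>lebesgue) < \<infinity>}"

definition has_weak_gradient ::
    "(real ^ 'n) set \<Rightarrow> (real ^ 'n \<Rightarrow> real) \<Rightarrow> (real ^ 'n \<Rightarrow> real ^ 'n) \<Rightarrow> bool" where
  "has_weak_gradient \<Omega> u g \<longleftrightarrow> u \<in> L1_loc \<Omega> \<and> g \<in> L1_loc \<Omega> \<and>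
     (\<forall>\<phi>\<in>C1c \<Omega>. (LINT x:\<Omega>|lebesgue. u x *\<^sub>R classical_gradient \<phi> x)
        = - (LINT x:\<Omega>|lebesgue. \<phi> x *\<^sub>R g x))"

text \<open>Weak gradients are unique only up to null sets; the following selects a representative.\<close>

definition weak_gradient ::
    "(real ^ 'n) set \<Rightarrow> (real ^ 'n \<Rightarrow> real) \<Rightarrow> real ^ 'n \<Rightarrow> real ^ 'n" where
  "weak_gradient \<Omega> u = (SOME g. has_weak_gradient \<Omega> u g)"

definition W11_loc :: "(real ^ 'n) set \<Rightarrow> (real ^ 'n \<Rightarrow> real) set" where
  "W11_loc \<Omega> = {u. \<exists>g. has_weak_gradient \<Omega> u g}"

definition W1p :: "real \<Rightarrow> (real ^ 'n) set \<Rightarrow> (real ^ 'n \<Rightarrow> real) set" where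
  "W1p p \<Omega> = {u \<in> W11_loc \<Omega>. (\<lambda>x. \<bar>u x\<bar> powr p) absolutely_integrable_on \<Omega> \<and>
     (\<lambda>x. norm (weak_gradient \<Omega> u x) powr p) absolutely_integrable_on \<Omega>}"

text \<open>\<open>W\<^sub>0\<^sup>1\<^sup>,\<^sup>p\<close>, for \<open>1 \<le> p < \<infinity>\<close>, is the closure of \<open>C1c \<Omega>\<close> in \<open>W1p p \<Omega>\<close>. The integral below is the
  \<open>p\<close>-th power of the Sobolev norm of \<open>u - \<phi> n\<close>; its integrand is integrable for
  \<open>u \<in> W1p p \<Omega>\<close> and \<open>\<phi> n \<in> C1c \<Omega>\<close>.\<close>

definition W1p_0 :: "real \<Rightarrow> (real ^ 'n) set \<Rightarrow> (real ^ 'n \<Rightarrow> real) set" where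
  "W1p_0 p \<Omega> = {u \<in> W1p p \<Omega>. \<exists>\<phi>::nat \<Rightarrow> real ^ 'n \<Rightarrow> real. (\<forall>n. \<phi> n \<in> C1c \<Omega>) \<and>
     (\<lambda>n. LINT x:\<Omega>|lebesgue. \<bar>u x - \<phi> n x\<bar> powr p +
        norm (weak_gradient \<Omega> u x - classical_gradient (\<phi> n) x) powr p) \<longlonglongrightarrow> 0}"

abbreviation H1_0 :: "(real ^ 'n) set \<Rightarrow> (real ^ 'n \<Rightarrow> real) set" where
  "H1_0 \<equiv> W1p_0 2"

definition truncation :: "real \<Rightarrow> real \<Rightarrow> real" where
  "truncation k s = max (- k) (min s k)"

text \<open>The product \<open>h(u)f\<close> is formed in \<open>ennreal\<close>, where \<open>\<infinity> * 0 = 0\<close>. Its local integrability makes it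
  finite almost everywhere, so that \<open>enn2real\<close> (which sends \<open>\<infinity>\<close> to \<open>0\<close>) alters it only on a null set.
  Functions are representatives of their classes: sign conditions hold almost everywhere, and
  \<open>h\<close> and \<open>powr\<close> are applied to negative arguments only on a null set.\<close>

definition distributional_solution ::
    "(real ^ 'n) set \<Rightarrow> (real ^ 'n \<Rightarrow> real ^ 'n ^ 'n) \<Rightarrow> (real \<Rightarrow> ennreal) \<Rightarrow> real \<Rightarrow>
     (real ^ 'n \<Rightarrow> real) \<Rightarrow> (real ^ 'n \<Rightarrow> real) \<Rightarrow> bool" where
  "distributional_solution \<Omega> A h \<gamma> f u \<longleftrightarrow>
     (AE x in lebesgue_on \<Omega>. 0 \<le> u x) \<and>
     u \<in> W11_loc \<Omega> \<and>
     (\<lambda>x. h (u x) * ennreal (f x)) \<in> L1_loc_ennreal \<Omega> \<and>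
     (let \<sigma> = max 1 \<gamma> in
       \<forall>k>0. (\<lambda>x. truncation k (u x) powr ((\<sigma> + 1) / 2)) \<in> W1p_0 1 \<Omega>) \<and>
     (\<forall>\<phi>\<in>C1c \<Omega>. (LINT x:\<Omega>|lebesgue. (A x *v weak_gradient \<Omega> u x) \<bullet> classical_gradient \<phi> x)
        = (LINT x:\<Omega>|lebesgue. enn2real (h (u x) * ennreal (f x)) * \<phi> x))"

definition weak_solution ::
    "(real ^ 'n) set \<Rightarrow> (real ^ 'n \<Rightarrow> real ^ 'n ^ 'n) \<Rightarrow> (real \<Rightarrow> ennreal) \<Rightarrow> real \<Rightarrow>
     (real ^ 'n \<Rightarrow> real) \<Rightarrow> (real ^ 'n \<Rightarrow> real) \<Rightarrow> bool" where
  "weak_solution \<Omega> A h \<gamma> f u \<longleftrightarrow> distributional_solution \<Omega> A h \<gamma> f u \<and> u \<in> H1_0 \<Omega>"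

end

theory Submission
  imports Defs
begin

text \<open>Let \<open>w = u - v\<close> and \<open>G = \<nabla>u - \<nabla>v\<close>, and let \<open>p n \<rightarrow> w\<close> be test functions converging in the
  Sobolev norm and almost everywhere. The difference of the two equations has right-hand side
  \<open>F = (h(u) - h(v)) f\<close>, which is only locally integrable but satisfies \<open>F w \<le> 0\<close>. To exploit this sign, the
  equation is tested with \<open>\<theta>(p n, \<psi>)\<close>, where \<open>\<psi>\<close> is a test function and \<open>\<theta>(s,t) = s t\<^sup>2 / (1 + s\<^sup>2 + t\<^sup>2)\<close>
  has the sign of \<open>s\<close>, is bounded by \<open>t\<^sup>2\<close> and has bounded derivatives. Letting \<open>n \<rightarrow> \<infinity>\<close>, then
  \<open>\<psi> = p m \<rightarrow> w\<close>, gives \<open>\<integral> (\<theta>\<^sub>s + \<theta>\<^sub>t)(w,w) A G \<bullet> G \<le> 0\<close>, so \<open>G = 0\<close> wherever \<open>w \<noteq> 0\<close>.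
  Finally, integrating \<open>x\<^sub>i \<partial>\<^sub>i\<close> of \<open>(p n)\<^sup>2 / (1 + (p n)\<^sup>2)\<close> by parts and passing to the limit shows that
  \<open>\<integral> w\<^sup>2 / (1 + w\<^sup>2) = 0\<close>. Since only smooth functions are composed, neither a chain rule for weak
  gradients nor their uniqueness enters.\<close>

section \<open>Test functions\<close>

text \<open>Uniqueness of the derivative at a point. The gradients of differences and composites
  below are all obtained by exhibiting a derivative in the form of an inner product.\<close>

lemma classical_gradient_eq:
  assumes "(\<phi> has_derivative (\<lambda>h. g \<bullet> h)) (at x)"
  shows "classical_gradient \<phi> x = g"
proof -
  have "frechet_derivative \<phi> (at x) = (\<lambda>h. g \<bullet> h)"
    using assms frechet_derivative_at by fastforce
  then show ?thesis
    by (simp add: classical_gradient_def vec_eq_iff inner_axis)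
qed

lemma has_derivative_classical_gradient:
  fixes \<phi> :: "real ^ 'n \<Rightarrow> real"
  assumes "\<phi> differentiable (at x)"
  shows "(\<phi> has_derivative (\<lambda>h. classical_gradient \<phi> x \<bullet> h)) (at x)"
proof -
  have d: "(\<phi> has_derivative frechet_derivative \<phi> (at x)) (at x)"
    using assms frechet_derivative_works by blast
  then have lin: "linear (frechet_derivative \<phi> (at x))"
    by (rule has_derivative_linear)
  have "frechet_derivative \<phi> (at x) h = classical_gradient \<phi> x \<bullet> h" for h
  proof -
    have "frechet_derivative \<phi> (at x) h = frechet_derivative \<phi> (at x) (\<Sum>i\<in>UNIV. h $ i *\<^sub>R axis i 1)"
      using basis_expansion[of h] by (simp add: scalar_mult_eq_scaleR)
    also have "\<dots> = (\<Sum>i\<in>UNIV. h $ i * frechet_derivative \<phi> (at x) (axis i 1))"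
      by (simp add: linear_sum[OF lin] linear_cmul[OF lin])
    finally show ?thesis
      by (simp add: classical_gradient_def inner_vec_def mult.commute)
  qed
  then have "frechet_derivative \<phi> (at x) = (\<lambda>h. classical_gradient \<phi> x \<bullet> h)" by blast
  with d show ?thesis by simp
qed

lemma C1c_has_derivative:
  "\<phi> \<in> C1c \<Omega> \<Longrightarrow> (\<phi> has_derivative (\<lambda>h. classical_gradient \<phi> x \<bullet> h)) (at x)"
  by (simp add: C1c_def has_derivative_classical_gradient)

lemma C1c_continuous_gradient: "\<phi> \<in> C1c \<Omega> \<Longrightarrow> continuous_on UNIV (classical_gradient \<phi>)"
  by (simp add: C1c_def)

lemma C1c_continuous: "\<phi> \<in> C1c \<Omega> \<Longrightarrow> continuous_on UNIV \<phi>"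
  by (meson C1c_has_derivative continuous_at_imp_continuous_on has_derivative_continuous)

text \<open>Any compact \<open>K\<close> outside of which \<open>\<phi>\<close> vanishes can serve
  as certificate: being closed, it contains the closure of the support.\<close>

lemma C1cI:
  fixes \<phi> :: "real ^ 'n \<Rightarrow> real"
  assumes d: "\<And>x. (\<phi> has_derivative (\<lambda>h. g x \<bullet> h)) (at x)"
    and g: "continuous_on UNIV g"
    and K: "compact K" "K \<subseteq> \<Omega>" "\<And>x. x \<notin> K \<Longrightarrow> \<phi> x = 0"
  shows "\<phi> \<in> C1c \<Omega>"
proof -
  have "closure {x. \<phi> x \<noteq> 0} \<subseteq> K"
    using K compact_imp_closed by (intro closure_minimal) auto
  moreover have "compact (closure {x. \<phi> x \<noteq> 0})"
    using calculation K(1) compact_Int_closed[OF K(1) closed_closure]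
    by (metis inf.absorb_iff2)
  moreover have "classical_gradient \<phi> = g"
    using classical_gradient_eq[OF d] by auto
  ultimately show ?thesis
    using g K(2) d unfolding C1c_def differentiable_def by blast
qed

text \<open>The complement of the closed support is open, so \<open>\<phi>\<close> is zero near each
  of its points and the gradient vanishes there as well.\<close>

lemma C1c_support:
  fixes \<phi> :: "real ^ 'n \<Rightarrow> real"
  assumes "\<phi> \<in> C1c \<Omega>"
  shows "\<exists>K. compact K \<and> K \<subseteq> \<Omega> \<and> (\<forall>x. x \<notin> K \<longrightarrow> \<phi> x = 0 \<and> classical_gradient \<phi> x = 0)"
proof -
  define K where "K = closure {x. \<phi> x \<noteq> 0}"
  have K: "compact K" "K \<subseteq> \<Omega>" using assms unfolding C1c_def K_def by blast+
  have z: "\<phi> x = 0" if "x \<notin> K" for x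
    using that closure_subset[of "{x. \<phi> x \<noteq> 0}"] unfolding K_def by blast
  have "classical_gradient \<phi> x = 0" if "x \<notin> K" for x
  proof (rule classical_gradient_eq)
    have "((\<lambda>_. 0) has_derivative (\<lambda>h. 0)) (at x)" by simp
    then have "(\<phi> has_derivative (\<lambda>h. 0)) (at x)"
      by (rule has_derivative_transform_within_open[where s="- K"])
        (use that z K(1) compact_imp_closed in auto)
    then show "(\<phi> has_derivative (\<lambda>h. 0 \<bullet> h)) (at x)" by simp
  qed
  with K z show ?thesis by blast
qed

lemma bounded_range_if_compact_support:
  fixes f :: "'a::metric_space \<Rightarrow> 'b::real_normed_vector"
  assumes "continuous_on UNIV f" "compact K" "\<And>x. x \<notin> K \<Longrightarrow> f x = 0"
  shows "\<exists>C\<ge>0. \<forall>x. norm (f x) \<le> C"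
proof -
  have "bounded (f ` K)"
    using assms by (meson compact_continuous_image compact_imp_bounded continuous_on_subset subset_UNIV)
  then obtain C where "\<forall>x\<in>K. norm (f x) \<le> C" by (auto simp: bounded_iff)
  \<comment> \<open>If \<open>K\<close> is empty, \<open>C\<close> may be negative; the maximum with
    0 also bounds the value 0 taken off \<open>K\<close>.\<close>
  then have "norm (f x) \<le> max 0 C" for x using assms(3)[of x] by (cases "x \<in> K") auto
  then show ?thesis by (intro exI[of _ "max 0 C"]) auto
qed

lemma C1c_diff:
  fixes \<phi> \<psi> :: "real ^ 'n \<Rightarrow> real"
  assumes \<phi>: "\<phi> \<in> C1c \<Omega>" and \<psi>: "\<psi> \<in> C1c \<Omega>"
  shows "(\<lambda>x. \<phi> x - \<psi> x) \<in> C1c \<Omega>"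
    and "classical_gradient (\<lambda>x. \<phi> x - \<psi> x) x = classical_gradient \<phi> x - classical_gradient \<psi> x"
proof -
  have d: "((\<lambda>x. \<phi> x - \<psi> x) has_derivative
      (\<lambda>h. (classical_gradient \<phi> x - classical_gradient \<psi> x) \<bullet> h)) (at x)" for x
    using has_derivative_diff[OF C1c_has_derivative[OF \<phi>] C1c_has_derivative[OF \<psi>]]
    by (simp add: inner_diff_left)
  obtain K where K: "compact K" "K \<subseteq> \<Omega>" "\<And>x. x \<notin> K \<Longrightarrow> \<phi> x = 0" using C1c_support[OF \<phi>] by auto
  obtain L where L: "compact L" "L \<subseteq> \<Omega>" "\<And>x. x \<notin> L \<Longrightarrow> \<psi> x = 0" using C1c_support[OF \<psi>] by auto
  show "(\<lambda>x. \<phi> x - \<psi> x) \<in> C1c \<Omega>"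
  proof (rule C1cI[OF d])
    show "compact (K \<union> L)" "K \<union> L \<subseteq> \<Omega>" using K L by auto
    show "\<phi> x - \<psi> x = 0" if "x \<notin> K \<union> L" for x using that K L by simp
  qed (intro continuous_on_diff C1c_continuous_gradient[OF \<phi>] C1c_continuous_gradient[OF \<psi>])
  show "classical_gradient (\<lambda>x. \<phi> x - \<psi> x) x = classical_gradient \<phi> x - classical_gradient \<psi> x"
    by (rule classical_gradient_eq[OF d])
qed

section \<open>Integrals of partial derivatives of test functions\<close>

lemma integral_lborel_translate:
  fixes f :: "'a::euclidean_space \<Rightarrow> real"
  assumes [measurable]: "f \<in> borel_measurable borel"
  shows "(\<integral>x. f (c + x) \<partial>lborel) = (\<integral>x. f x \<partial>lborel)"
    and "integrable lborel (\<lambda>x. f (c + x)) \<longleftrightarrow> integrable lborel f"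
proof -
  have m: "(\<lambda>x. c + x) \<in> lborel \<rightarrow>\<^sub>M borel" by simp
  show "(\<integral>x. f (c + x) \<partial>lborel) = (\<integral>x. f x \<partial>lborel)"
    using integral_distr[OF m assms] by (simp add: lborel_distr_plus)
  show "integrable lborel (\<lambda>x. f (c + x)) \<longleftrightarrow> integrable lborel f"
    using integrable_distr_eq[OF m assms] by (simp add: lborel_distr_plus)
qed

text \<open>By translation invariance all difference quotients have integral zero.\<close>

lemma integral_partial_derivative_C1c:
  fixes \<eta> :: "real ^ 'n \<Rightarrow> real"
  assumes \<eta>: "\<eta> \<in> C1c \<Omega>" and \<Omega>: "\<Omega> \<in> sets lebesgue"
  shows "(\<integral>x. classical_gradient \<eta> x $ i \<partial>lebesgue_on \<Omega>) = 0"
proof -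
  obtain K where K: "compact K" "K \<subseteq> \<Omega>"
    "\<And>x. x \<notin> K \<Longrightarrow> \<eta> x = 0" "\<And>x. x \<notin> K \<Longrightarrow> classical_gradient \<eta> x = 0"
    using C1c_support[OF \<eta>] by auto
  obtain C where C: "C \<ge> 0" "\<And>x. norm (classical_gradient \<eta> x) \<le> C"
    using bounded_range_if_compact_support[OF C1c_continuous_gradient[OF \<eta>] K(1) K(4)] by auto
  obtain R where R: "\<And>x. x \<in> K \<Longrightarrow> norm x \<le> R"
    using compact_imp_bounded[OF K(1)] by (auto simp: bounded_iff)
  let ?e = "axis i 1 :: real ^ 'n"
  \<comment> \<open>Steps of length at most 1 keep all shifted supports inside the ball of radius
    \<open>R + 1\<close>, which carries a common majorant of the difference quotients.\<close>
  define t where "t k = 1 / real (Suc k)" for k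
  have t: "0 < t k" "t k \<le> 1" for k by (auto simp: t_def)
  have t0: "t \<longlonglongrightarrow> 0" unfolding t_def by (rule LIMSEQ_Suc[OF lim_inverse_n'])
  define D where "D k x = (\<eta> (t k *\<^sub>R ?e + x) - \<eta> x) / t k" for k x
  have cont[measurable]: "\<eta> \<in> borel_measurable borel"
    using C1c_continuous[OF \<eta>] by (rule borel_measurable_continuous_onI)
  have contg[measurable]: "(\<lambda>x. classical_gradient \<eta> x $ i) \<in> borel_measurable borel"
    using C1c_continuous_gradient[OF \<eta>] by (intro borel_measurable_continuous_onI continuous_intros)
  have int\<eta>: "integrable lborel \<eta>"
  proof -
    have "(\<lambda>x. indicator K x *\<^sub>R \<eta> x) = \<eta>"
    proof
      show "indicator K x *\<^sub>R \<eta> x = \<eta> x" for x using K(3) by (cases "x \<in> K") auto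
    qed
    then show ?thesis
      using borel_integrable_compact[OF K(1) continuous_on_subset[OF C1c_continuous[OF \<eta>]]] by simp
  qed
  have D0: "(\<integral>x. D k x \<partial>lborel) = 0" for k
    unfolding D_def using int\<eta>
    by (simp add: integral_lborel_translate)
  have DC: "norm (D k x) \<le> C * indicator (cball 0 (R + 1)) x" for k x
  proof (cases "norm x \<le> R + 1")
    case True
    have "norm (\<eta> (t k *\<^sub>R ?e + x) - \<eta> x) \<le> C * norm ((t k *\<^sub>R ?e + x) - x)"
    proof (rule differentiable_bound[of UNIV \<eta> "\<lambda>x h. classical_gradient \<eta> x \<bullet> h"])
      show "onorm (\<lambda>h. classical_gradient \<eta> x \<bullet> h) \<le> C" for x
        by (rule onorm_le, unfold real_norm_def)
          (rule order_trans[OF Cauchy_Schwarz_ineq2 mult_right_mono[OF C(2) norm_ge_zero]])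
    qed (use C1c_has_derivative[OF \<eta>] in auto)
    then have "\<bar>\<eta> (t k *\<^sub>R ?e + x) - \<eta> x\<bar> \<le> C * t k" using t[of k] by simp
    then show ?thesis using True t[of k] by (simp add: D_def divide_le_eq)
  next
    case False
    \<comment> \<open>Outside the ball the shifted point still has norm above \<open>R\<close>, so
      both values in the difference quotient are 0.\<close>
    have "norm (t k *\<^sub>R ?e + x) \<ge> norm x - norm (t k *\<^sub>R ?e)"
      by (metis add.commute norm_diff_ineq)
    then have "norm (t k *\<^sub>R ?e + x) > R" using False t[of k] by simp
    then have "\<eta> (t k *\<^sub>R ?e + x) = 0" "\<eta> x = 0" using K(3) R False by fastforce+
    then show ?thesis using C by (simp add: D_def)
  qed
  have lim: "(\<lambda>k. D k x) \<longlonglongrightarrow> classical_gradient \<eta> x $ i" for x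
  proof -
    have "((\<lambda>s. \<eta> (s *\<^sub>R ?e + x)) has_derivative (\<lambda>s. classical_gradient \<eta> x \<bullet> (s *\<^sub>R ?e))) (at 0)"
    proof (rule has_derivative_compose[of "\<lambda>s. s *\<^sub>R ?e + x" "\<lambda>s. s *\<^sub>R ?e" 0 UNIV \<eta>])
      show "((\<lambda>s. s *\<^sub>R ?e + x) has_derivative (\<lambda>s. s *\<^sub>R ?e)) (at 0)"
        by (auto intro!: derivative_eq_intros)
      show "(\<eta> has_derivative (\<bullet>) (classical_gradient \<eta> x)) (at (0 *\<^sub>R ?e + x))"
        using C1c_has_derivative[OF \<eta>, of x] by simp
    qed
    then have "((\<lambda>s. \<eta> (s *\<^sub>R ?e + x)) has_real_derivative classical_gradient \<eta> x $ i) (at 0)"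
      by (simp add: has_field_derivative_def inner_axis mult.commute[of _ "classical_gradient \<eta> x $ i"] cong: if_cong)
    then have "((\<lambda>s. (\<eta> (s *\<^sub>R ?e + x) - \<eta> x) / s) \<longlongrightarrow> classical_gradient \<eta> x $ i) (at 0)"
      by (simp add: has_field_derivative_iff)
    moreover have "filterlim t (at 0) sequentially"
    proof -
      have "t k \<noteq> 0" for k using t(1)[of k] by simp
      with t0 show ?thesis by (simp add: filterlim_at)
    qed
    ultimately show ?thesis unfolding D_def by (rule filterlim_compose)
  qed
  have "(\<lambda>k. \<integral>x. D k x \<partial>lborel) \<longlonglongrightarrow> (\<integral>x. classical_gradient \<eta> x $ i \<partial>lborel)"
  proof (rule integral_dominated_convergence[where w="\<lambda>x. C * indicator (cball 0 (R + 1)) x"])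
    show "D k \<in> borel_measurable lborel" for k unfolding D_def by measurable
    have "emeasure lborel (cball (0::real^'n) (R+1)) < \<infinity>"
      using emeasure_bounded_finite by blast
    then show "integrable lborel (\<lambda>x::real^'n. C * indicator (cball 0 (R + 1)) x)" by simp
  qed (use lim DC in auto)
  then have "(\<integral>x. classical_gradient \<eta> x $ i \<partial>lborel) = 0"
    unfolding D0 by (rule LIMSEQ_unique[OF _ tendsto_const])
  \<comment> \<open>The gradient vanishes off \<open>K\<close>, which lies in
    \<open>\<Omega>\<close>; hence restricting the integral to \<open>\<Omega>\<close> does not
    change it.\<close>
  moreover have "(\<integral>x. classical_gradient \<eta> x $ i \<partial>lebesgue_on \<Omega>) = (\<integral>x. classical_gradient \<eta> x $ i \<partial>lebesgue)"
  proof -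
    have "indicator \<Omega> x *\<^sub>R (classical_gradient \<eta> x $ i) = classical_gradient \<eta> x $ i" for x
    proof (cases "x \<in> \<Omega>")
      case False
      then have "x \<notin> K" using K(2) by blast
      then show ?thesis using K(4) by simp
    qed simp
    then show ?thesis using \<Omega> by (simp only: integral_restrict_space sets.Int_space_eq2)
  qed
  moreover have "(\<integral>x. classical_gradient \<eta> x $ i \<partial>lebesgue) = (\<integral>x. classical_gradient \<eta> x $ i \<partial>lborel)"
    by (rule integral_completion) simp
  ultimately show ?thesis by simp
qed

section \<open>Passage to the limit\<close>

text \<open>The parallelogram law with the square of \<open>norm (a + c)\<close> dropped.\<close>

lemma power2_norm_diff_le:
  fixes a c :: "'a::real_inner"
  shows "(norm (a - c))\<^sup>2 \<le> 2 * (norm a)\<^sup>2 + 2 * (norm c)\<^sup>2"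
proof -
  have "(norm (a - c))\<^sup>2 + (norm (a + c))\<^sup>2 = 2 * (norm a)\<^sup>2 + 2 * (norm c)\<^sup>2"
    by (simp add: power2_norm_eq_inner inner_simps inner_commute)
  then show ?thesis using zero_le_power2[of "norm (a + c)"] by linarith
qed

lemma (in finite_measure) integrable_power2_norm_bounded:
  fixes f :: "'a \<Rightarrow> 'b::euclidean_space"
  assumes [measurable]: "f \<in> borel_measurable M" and "\<And>x. x \<in> space M \<Longrightarrow> norm (f x) \<le> C"
  shows "integrable M (\<lambda>x. (norm (f x))\<^sup>2)"
  by (rule integrable_const_bound[where B="C\<^sup>2"]) (use assms in \<open>auto intro!: power_mono AE_I2\<close>)

lemma integrable_power2_norm_diff:
  fixes a c :: "'a \<Rightarrow> 'b::euclidean_space"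
  assumes [measurable]: "a \<in> borel_measurable M" "c \<in> borel_measurable M"
    and a: "integrable M (\<lambda>x. (norm (a x))\<^sup>2)" and c: "integrable M (\<lambda>x. (norm (c x))\<^sup>2)"
  shows "integrable M (\<lambda>x. (norm (a x - c x))\<^sup>2)"
    and "(\<integral>x. (norm (a x - c x))\<^sup>2 \<partial>M) \<le> 2 * (\<integral>x. (norm (a x))\<^sup>2 \<partial>M) + 2 * (\<integral>x. (norm (c x))\<^sup>2 \<partial>M)"
proof -
  have i: "integrable M (\<lambda>x. 2 * (norm (a x))\<^sup>2 + 2 * (norm (c x))\<^sup>2)" using a c by auto
  show 1: "integrable M (\<lambda>x. (norm (a x - c x))\<^sup>2)"
    by (rule Bochner_Integration.integrable_bound[OF i]) (use power2_norm_diff_le in \<open>auto intro!: AE_I2\<close>)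
  have "(\<integral>x. (norm (a x - c x))\<^sup>2 \<partial>M) \<le> (\<integral>x. 2 * (norm (a x))\<^sup>2 + 2 * (norm (c x))\<^sup>2 \<partial>M)"
    by (rule integral_mono[OF 1 i]) (rule power2_norm_diff_le)
  then show "(\<integral>x. (norm (a x - c x))\<^sup>2 \<partial>M) \<le> 2 * (\<integral>x. (norm (a x))\<^sup>2 \<partial>M) + 2 * (\<integral>x. (norm (c x))\<^sup>2 \<partial>M)"
    using a c by simp
qed

lemma tendsto_L2_diff:
  fixes a c :: "nat \<Rightarrow> 'a \<Rightarrow> 'b::euclidean_space"
  assumes "\<And>n. a n \<in> borel_measurable M" "\<And>n. c n \<in> borel_measurable M"
    and "\<And>n. integrable M (\<lambda>x. (norm (a n x))\<^sup>2)" "\<And>n. integrable M (\<lambda>x. (norm (c n x))\<^sup>2)"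
    and a: "(\<lambda>n. \<integral>x. (norm (a n x))\<^sup>2 \<partial>M) \<longlonglongrightarrow> 0" and c: "(\<lambda>n. \<integral>x. (norm (c n x))\<^sup>2 \<partial>M) \<longlonglongrightarrow> 0"
  shows "(\<lambda>n. \<integral>x. (norm (a n x - c n x))\<^sup>2 \<partial>M) \<longlonglongrightarrow> 0"
proof (rule tendsto_sandwich[OF _ _ tendsto_const])
  show "(\<lambda>n. 2 * (\<integral>x. (norm (a n x))\<^sup>2 \<partial>M) + 2 * (\<integral>x. (norm (c n x))\<^sup>2 \<partial>M)) \<longlonglongrightarrow> 0"
    using tendsto_add[OF tendsto_mult_right_zero[OF a, of 2] tendsto_mult_right_zero[OF c, of 2]] by simp
qed (use integrable_power2_norm_diff(2)[OF assms(1-4)] in auto)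

text \<open>Cauchy-Schwarz at each point, followed by the arithmetic-geometric mean inequality,
  yields the sum of the two squares as majorant.\<close>

lemma integrable_inner_L2:
  fixes V W :: "'a \<Rightarrow> 'b::euclidean_space"
  assumes [measurable]: "V \<in> borel_measurable M" "W \<in> borel_measurable M" "b \<in> borel_measurable M"
    and V: "integrable M (\<lambda>x. (norm (V x))\<^sup>2)" and W: "integrable M (\<lambda>x. (norm (W x))\<^sup>2)"
    and b: "AE x in M. \<bar>b x\<bar> \<le> C"
  shows "integrable M (\<lambda>x. b x * (V x \<bullet> W x))"
proof (rule Bochner_Integration.integrable_bound[where f="\<lambda>x. C * ((norm (V x))\<^sup>2 + (norm (W x))\<^sup>2)"])
  show "AE x in M. norm (b x * (V x \<bullet> W x)) \<le> norm (C * ((norm (V x))\<^sup>2 + (norm (W x))\<^sup>2))"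
    using b
  proof eventually_elim
    case (elim x)
    have "\<bar>V x \<bullet> W x\<bar> \<le> norm (V x) * norm (W x)" by (rule Cauchy_Schwarz_ineq2)
    also have "\<dots> \<le> (norm (V x))\<^sup>2 + (norm (W x))\<^sup>2"
      using sum_squares_bound[of "norm (V x)" "norm (W x)"]
        mult_nonneg_nonneg[OF norm_ge_zero[of "V x"] norm_ge_zero[of "W x"]] by linarith
    finally have "\<bar>b x\<bar> * \<bar>V x \<bullet> W x\<bar> \<le> C * ((norm (V x))\<^sup>2 + (norm (W x))\<^sup>2)"
      using elim by (intro mult_mono) auto
    also have "\<dots> \<le> \<bar>C\<bar> * ((norm (V x))\<^sup>2 + (norm (W x))\<^sup>2)"
      by (intro mult_right_mono) auto
    finally show ?case by (simp add: abs_mult)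
  qed
qed (use V W in auto)

text \<open>Every limit below that involves gradients is an instance, sometimes with
  \<open>g\<close> constant in \<open>n\<close>. Writing \<open>g n\<close> as
  \<open>G - (G - g n)\<close>, the first part converges by dominated convergence, as the
  coefficients are bounded and converge almost everywhere; the second is at most \<open>C\<close>
  times the integral \<open>I n\<close>, which tends to 0 by the convergence of \<open>g n\<close>
  in the mean square.\<close>

lemma tendsto_integral_mult_inner_L2:
  fixes V G :: "'a \<Rightarrow> 'b::euclidean_space" and g :: "nat \<Rightarrow> 'a \<Rightarrow> 'b"
  assumes m[measurable]: "V \<in> borel_measurable M" "G \<in> borel_measurable M" "\<And>n. g n \<in> borel_measurable M"
      "\<And>n. b n \<in> borel_measurable M" "B \<in> borel_measurable M"
    and V: "integrable M (\<lambda>x. (norm (V x))\<^sup>2)" and G: "integrable M (\<lambda>x. (norm (G x))\<^sup>2)"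
    and g: "\<And>n. integrable M (\<lambda>x. (norm (g n x))\<^sup>2)"
    and gG: "(\<lambda>n. \<integral>x. (norm (G x - g n x))\<^sup>2 \<partial>M) \<longlonglongrightarrow> 0"
    and bB: "AE x in M. (\<lambda>n. b n x) \<longlonglongrightarrow> B x"
    and bC: "\<And>n x. \<bar>b n x\<bar> \<le> C"
  shows "(\<lambda>n. \<integral>x. b n x * (V x \<bullet> g n x) \<partial>M) \<longlonglongrightarrow> (\<integral>x. B x * (V x \<bullet> G x) \<partial>M)"
proof -
  have C: "C \<ge> 0" using bC[of 0 undefined] by linarith
  have Gg: "integrable M (\<lambda>x. (norm (G x - g n x))\<^sup>2)" for n
    by (rule integrable_power2_norm_diff(1)[OF m(2,3) G g])
  define I where "I n = (\<integral>x. \<bar>V x \<bullet> (G x - g n x)\<bar> \<partial>M)" for n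
  have intI: "integrable M (\<lambda>x. V x \<bullet> (G x - g n x))" for n
    using integrable_inner_L2[of V M "\<lambda>x. G x - g n x" "\<lambda>_. 1" 1] V Gg by simp
  have I: "I \<longlonglongrightarrow> 0"
  proof (rule LIMSEQ_I)
    fix r :: real assume r: "r > 0"
    define v where "v = (\<integral>x. (norm (V x))\<^sup>2 \<partial>M)"
    have v: "v \<ge> 0" by (simp add: v_def)
    \<comment> \<open>The weight of the Young inequality below: it makes \<open>e * v\<close> at
      most \<open>r / 2\<close>, and \<open>v + 1\<close> keeps the denominator positive when
      \<open>v = 0\<close>. The bound \<open>r / 4 * e\<close> on the squared distance then
      contributes less than \<open>r / 4\<close> after division by \<open>e\<close>.\<close>
    define e where "e = r / (2 * (v + 1))"
    have e: "e > 0" "e * v < r / 2 + r / 4"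
    proof -
      show "e > 0" using r v by (simp add: e_def)
      have "e * v \<le> e * (v + 1)" using \<open>e > 0\<close> by simp
      also have "\<dots> = r / 2" using v by (simp add: e_def field_simps)
      finally show "e * v < r / 2 + r / 4" using r by simp
    qed
    have "\<forall>\<^sub>F n in sequentially. (\<integral>x. (norm (G x - g n x))\<^sup>2 \<partial>M) < r / 4 * e"
      using order_tendstoD(2)[OF gG, of "r / 4 * e"] e r by simp
    then obtain n0 where n0: "\<And>n. n \<ge> n0 \<Longrightarrow> (\<integral>x. (norm (G x - g n x))\<^sup>2 \<partial>M) < r / 4 * e"
      by (auto simp: eventually_sequentially)
    have "I n < r" if "n \<ge> n0" for n
    proof -
      \<comment> \<open>Young's inequality with weight \<open>e\<close>, from the nonnegative square
        of \<open>e * norm a - norm c\<close>; the sharp factor 1/2 is given away.\<close>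
      have young: "\<bar>a \<bullet> c\<bar> \<le> e * (norm a)\<^sup>2 + (norm c)\<^sup>2 / e" for a c :: 'b
      proof -
        have "0 \<le> (e * norm a - norm c)\<^sup>2" by simp
        then have "2 * (e * (norm a * norm c)) \<le> e\<^sup>2 * (norm a)\<^sup>2 + (norm c)\<^sup>2"
          by (simp add: power2_eq_square algebra_simps)
        moreover have "0 \<le> e * (norm a * norm c)" using \<open>e > 0\<close> by simp
        ultimately have "e * (norm a * norm c) \<le> e\<^sup>2 * (norm a)\<^sup>2 + (norm c)\<^sup>2"
          by linarith
        then have "norm a * norm c \<le> e * (norm a)\<^sup>2 + (norm c)\<^sup>2 / e"
          using e by (simp add: field_simps power2_eq_square)
        then show ?thesis using Cauchy_Schwarz_ineq2[of a c] by linarith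
      qed
      have "I n \<le> (\<integral>x. e * (norm (V x))\<^sup>2 + (norm (G x - g n x))\<^sup>2 / e \<partial>M)"
        unfolding I_def
        by (rule integral_mono) (use intI V Gg young in auto)
      also have "\<dots> = e * v + (\<integral>x. (norm (G x - g n x))\<^sup>2 \<partial>M) / e"
        using V Gg by (simp add: v_def)
      also have "\<dots> < (r / 2 + r / 4) + r / 4"
        using e n0[OF that] by (intro add_strict_mono) (simp_all add: divide_less_eq)
      finally show ?thesis by simp
    qed
    moreover have "I n \<ge> 0" for n by (simp add: I_def)
    ultimately show "\<exists>no. \<forall>n\<ge>no. norm (I n - 0) < r" by auto
  qed
  have "(\<lambda>n. \<integral>x. b n x * (V x \<bullet> (G x - g n x)) \<partial>M) \<longlonglongrightarrow> 0"
  proof (rule Lim_null_comparison)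
    show "\<forall>\<^sub>F n in sequentially. norm (\<integral>x. b n x * (V x \<bullet> (G x - g n x)) \<partial>M) \<le> C * I n"
    proof (rule always_eventually, rule allI)
      fix n
      have "norm (\<integral>x. b n x * (V x \<bullet> (G x - g n x)) \<partial>M) \<le> (\<integral>x. norm (b n x * (V x \<bullet> (G x - g n x))) \<partial>M)"
        by (rule integral_norm_bound)
      also have "\<dots> \<le> (\<integral>x. C * \<bar>V x \<bullet> (G x - g n x)\<bar> \<partial>M)"
      proof (rule integral_mono)
        show "integrable M (\<lambda>x. norm (b n x * (V x \<bullet> (G x - g n x))))"
          by (intro integrable_norm integrable_inner_L2[where C=C]) (use V Gg bC in auto)
      qed (use intI bC in \<open>auto simp: abs_mult intro!: mult_right_mono\<close>)
      also have "\<dots> = C * I n" by (simp add: I_def)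
      finally show "norm (\<integral>x. b n x * (V x \<bullet> (G x - g n x)) \<partial>M) \<le> C * I n" .
    qed
    show "(\<lambda>n. C * I n) \<longlonglongrightarrow> 0" using tendsto_mult_right_zero[OF I] .
  qed
  moreover have "(\<lambda>n. \<integral>x. b n x * (V x \<bullet> G x) \<partial>M) \<longlonglongrightarrow> (\<integral>x. B x * (V x \<bullet> G x) \<partial>M)"
  proof (rule integral_dominated_convergence[where w="\<lambda>x. C * \<bar>V x \<bullet> G x\<bar>"])
    show "AE x in M. (\<lambda>n. b n x * (V x \<bullet> G x)) \<longlonglongrightarrow> B x * (V x \<bullet> G x)"
      using bB by eventually_elim (intro tendsto_intros)
    show "integrable M (\<lambda>x. C * \<bar>V x \<bullet> G x\<bar>)"
      using integrable_inner_L2[of V M G "\<lambda>_. 1" 1] V G by auto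
    show "AE x in M. norm (b n x * (V x \<bullet> G x)) \<le> C * \<bar>V x \<bullet> G x\<bar>" for n
      using bC by (auto simp: abs_mult intro!: mult_right_mono)
  qed measurable
  ultimately have "(\<lambda>n. (\<integral>x. b n x * (V x \<bullet> G x) \<partial>M) - (\<integral>x. b n x * (V x \<bullet> (G x - g n x)) \<partial>M))
      \<longlonglongrightarrow> (\<integral>x. B x * (V x \<bullet> G x) \<partial>M) - 0"
    by (intro tendsto_diff)
  moreover have "(\<integral>x. b n x * (V x \<bullet> G x) \<partial>M) - (\<integral>x. b n x * (V x \<bullet> (G x - g n x)) \<partial>M)
      = (\<integral>x. b n x * (V x \<bullet> g n x) \<partial>M)" for n
  proof -
    have "integrable M (\<lambda>x. b n x * (V x \<bullet> G x))" "integrable M (\<lambda>x. b n x * (V x \<bullet> (G x - g n x)))"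
      by (intro integrable_inner_L2[where C=C]; use V G Gg bC in auto)+
    then show ?thesis
      by (simp flip: Bochner_Integration.integral_diff) (simp add: inner_diff_right algebra_simps)
  qed
  ultimately show ?thesis by simp
qed

section \<open>A bounded substitute for the identity\<close>

text \<open>Replacing \<open>s\<close> by a convergent sequence of test functions and \<open>t\<close> by a fixed one yields test functions
  that are uniformly bounded and keep a fixed compact support.\<close>

definition damp :: "real \<Rightarrow> real \<Rightarrow> real" where
  "damp s t = s * t\<^sup>2 / (1 + s\<^sup>2 + t\<^sup>2)"

text \<open>The partial derivative of \<open>damp\<close> in its first argument.\<close>

definition damp_ds :: "real \<Rightarrow> real \<Rightarrow> real" where
  "damp_ds s t = t\<^sup>2 * (1 - s\<^sup>2 + t\<^sup>2) / (1 + s\<^sup>2 + t\<^sup>2)\<^sup>2"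

text \<open>The partial derivative of \<open>damp\<close> in its second argument.\<close>

definition damp_dt :: "real \<Rightarrow> real \<Rightarrow> real" where
  "damp_dt s t = 2 * s * t * (1 + s\<^sup>2) / (1 + s\<^sup>2 + t\<^sup>2)\<^sup>2"

lemma one_plus_squares_pos: "1 + s\<^sup>2 + t\<^sup>2 > (0::real)"
  by (intro add_pos_nonneg) auto

lemma one_plus_squares_nonzero: "1 + s\<^sup>2 + t\<^sup>2 \<noteq> (0::real)"
  using one_plus_squares_pos[of s t] by linarith

lemma has_derivative_damp:
  assumes f: "(f has_derivative f') (at x)" and g: "(g has_derivative g') (at x)"
  shows "((\<lambda>x. damp (f x) (g x)) has_derivative
    (\<lambda>h. damp_ds (f x) (g x) * f' h + damp_dt (f x) (g x) * g' h)) (at x)"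
proof -
  let ?d = "1 + (f x)\<^sup>2 + (g x)\<^sup>2"
  have nz: "?d \<noteq> 0" by (rule one_plus_squares_nonzero)
  have num: "((\<lambda>x. f x * (g x)\<^sup>2) has_derivative (\<lambda>h. f' h * (g x)\<^sup>2 + f x * (2 * g x * g' h))) (at x)"
    by (auto intro!: derivative_eq_intros f g simp: algebra_simps)
  have den: "((\<lambda>x. 1 + (f x)\<^sup>2 + (g x)\<^sup>2) has_derivative (\<lambda>h. 2 * f x * f' h + 2 * g x * g' h)) (at x)"
    by (auto intro!: derivative_eq_intros f g simp: algebra_simps)
  have eq: "((f' h * (g x)\<^sup>2 + f x * (2 * g x * g' h)) * ?d - f x * (g x)\<^sup>2 * (2 * f x * f' h + 2 * g x * g' h)) / (?d * ?d)
     = damp_ds (f x) (g x) * f' h + damp_dt (f x) (g x) * g' h" for h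
  proof -
    have "(f' h * (g x)\<^sup>2 + f x * (2 * g x * g' h)) * ?d - f x * (g x)\<^sup>2 * (2 * f x * f' h + 2 * g x * g' h)
      = (g x)\<^sup>2 * (1 - (f x)\<^sup>2 + (g x)\<^sup>2) * f' h + 2 * f x * g x * (1 + (f x)\<^sup>2) * g' h"
      by (simp add: power2_eq_square algebra_simps)
    then show ?thesis
      by (simp add: damp_ds_def damp_dt_def add_divide_distrib flip: power2_eq_square)
  qed
  show ?thesis
    using has_derivative_divide'[OF num den nz] unfolding eq damp_def .
qed

text \<open>From \<open>2 * \<bar>s\<bar> \<le> 1 + s\<^sup>2\<close> the factor multiplying
  \<open>t\<^sup>2\<close> has modulus at most 1. As the bound does not depend on \<open>s\<close>,
  it survives any limit in the first argument.\<close>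

lemma abs_damp_le: "\<bar>damp s t\<bar> \<le> t\<^sup>2"
proof -
  have "0 \<le> (1 - \<bar>s\<bar>)\<^sup>2" by simp
  then have "2 * \<bar>s\<bar> \<le> 1 + s\<^sup>2" by (simp add: power2_diff)
  then have "\<bar>s\<bar> \<le> 1 + s\<^sup>2 + t\<^sup>2" using zero_le_power2[of t] by linarith
  then have "\<bar>s\<bar> * t\<^sup>2 \<le> (1 + s\<^sup>2 + t\<^sup>2) * t\<^sup>2" by (rule mult_right_mono) simp
  then show ?thesis
    using one_plus_squares_pos[of s t] by (simp add: damp_def abs_mult divide_le_eq mult.commute)
qed

text \<open>The numerator is a product of two factors, each bounded in modulus by the base of the
  squared denominator.\<close>

lemma abs_damp_ds_le: "\<bar>damp_ds s t\<bar> \<le> 1"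
proof -
  have "\<bar>t\<^sup>2 * (1 - s\<^sup>2 + t\<^sup>2)\<bar> \<le> (1 + s\<^sup>2 + t\<^sup>2) * (1 + s\<^sup>2 + t\<^sup>2)"
    unfolding abs_mult by (intro mult_mono) (auto simp: abs_le_iff)
  then show ?thesis
    using one_plus_squares_pos[of s t] by (simp add: damp_ds_def divide_le_eq power2_eq_square[of "1 + s\<^sup>2 + t\<^sup>2"])
qed

text \<open>As for \<open>damp_ds\<close>, with \<open>2 * s * t\<close> controlled by the sum of
  the squares.\<close>

lemma abs_damp_dt_le: "\<bar>damp_dt s t\<bar> \<le> 1"
proof -
  have "0 \<le> (\<bar>s\<bar> - \<bar>t\<bar>)\<^sup>2" by simp
  then have "2 * \<bar>s\<bar> * \<bar>t\<bar> \<le> s\<^sup>2 + t\<^sup>2" by (simp add: power2_diff)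
  then have "\<bar>2 * s * t\<bar> \<le> 1 + s\<^sup>2 + t\<^sup>2" by (simp add: abs_mult)
  then have "\<bar>2 * s * t * (1 + s\<^sup>2)\<bar> \<le> (1 + s\<^sup>2 + t\<^sup>2) * (1 + s\<^sup>2 + t\<^sup>2)"
    unfolding abs_mult[of _ "1 + s\<^sup>2"] by (intro mult_mono) auto
  then show ?thesis
    using one_plus_squares_pos[of s t] by (simp add: damp_dt_def divide_le_eq power2_eq_square[of "1 + s\<^sup>2 + t\<^sup>2"])
qed

text \<open>\<open>damp s t\<close> is \<open>s\<close> times a nonnegative factor. This is how the
  sign of the product of \<open>F\<close> and \<open>w\<close> enters the argument.\<close>

lemma mult_damp_nonpos:
  assumes "c * s \<le> 0"
  shows "c * damp s t \<le> 0"
proof -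
  have "c * damp s t = (c * s) * (t\<^sup>2 / (1 + s\<^sup>2 + t\<^sup>2))" by (simp add: damp_def)
  also have "\<dots> \<le> 0"
    using one_plus_squares_pos[of s t] by (intro mult_nonpos_nonneg[OF assms]) auto
  finally show ?thesis .
qed

text \<open>The sum is the derivative of the diagonal function \<open>damp s s\<close>, that is of
  \<open>s ^ 3 / (1 + 2 * s\<^sup>2)\<close>, which is increasing with its only critical point at
  0.\<close>

lemma damp_ds_plus_dt_nonneg: "0 \<le> damp_ds s s + damp_dt s s"
  and damp_ds_plus_dt_eq_0: "damp_ds s s + damp_dt s s = 0 \<Longrightarrow> s = 0"
proof -
  have eq: "damp_ds s s + damp_dt s s = s\<^sup>2 * (3 + 2 * s\<^sup>2) / (1 + s\<^sup>2 + s\<^sup>2)\<^sup>2"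
    by (simp add: damp_ds_def damp_dt_def add_divide_distrib[symmetric] algebra_simps power2_eq_square)
  show "0 \<le> damp_ds s s + damp_dt s s" unfolding eq by simp
  have "3 + 2 * s\<^sup>2 > 0" by (intro add_pos_nonneg) auto
  then show "damp_ds s s + damp_dt s s = 0 \<Longrightarrow> s = 0"
    unfolding eq using one_plus_squares_nonzero[of s s] by simp
qed

lemma
  assumes "continuous_on S f" "continuous_on S g"
  shows continuous_on_damp_ds: "continuous_on S (\<lambda>x. damp_ds (f x) (g x))"
    and continuous_on_damp_dt: "continuous_on S (\<lambda>x. damp_dt (f x) (g x))"
  unfolding damp_ds_def damp_dt_def
  by (auto intro!: continuous_intros assms simp: one_plus_squares_nonzero)

lemma
  assumes "(f \<longlongrightarrow> a) X" "(g \<longlongrightarrow> b) X"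
  shows tendsto_damp: "((\<lambda>x. damp (f x) (g x)) \<longlongrightarrow> damp a b) X"
    and tendsto_damp_ds: "((\<lambda>x. damp_ds (f x) (g x)) \<longlongrightarrow> damp_ds a b) X"
    and tendsto_damp_dt: "((\<lambda>x. damp_dt (f x) (g x)) \<longlongrightarrow> damp_dt a b) X"
  unfolding damp_def damp_ds_def damp_dt_def
  by (auto intro!: tendsto_intros assms simp: one_plus_squares_nonzero)

lemma
  assumes [measurable]: "f \<in> borel_measurable M" "g \<in> borel_measurable M"
  shows measurable_damp[measurable]: "(\<lambda>x. damp (f x) (g x)) \<in> borel_measurable M"
    and measurable_damp_ds[measurable]: "(\<lambda>x. damp_ds (f x) (g x)) \<in> borel_measurable M"
    and measurable_damp_dt[measurable]: "(\<lambda>x. damp_dt (f x) (g x)) \<in> borel_measurable M"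
  unfolding damp_def damp_ds_def damp_dt_def by measurable

text \<open>\<open>damp\<close> vanishes with its second argument, so the composite is supported in
  a compact set that comes from \<open>\<psi>\<close> and stays the same for all
  \<open>\<phi>\<close>.\<close>

lemma C1c_damp:
  fixes \<phi> \<psi> :: "real ^ 'n \<Rightarrow> real"
  assumes \<phi>: "\<phi> \<in> C1c \<Omega>" and \<psi>: "\<psi> \<in> C1c \<Omega>"
  shows "(\<lambda>x. damp (\<phi> x) (\<psi> x)) \<in> C1c \<Omega>"
    and "classical_gradient (\<lambda>x. damp (\<phi> x) (\<psi> x)) x =
      damp_ds (\<phi> x) (\<psi> x) *\<^sub>R classical_gradient \<phi> x + damp_dt (\<phi> x) (\<psi> x) *\<^sub>R classical_gradient \<psi> x"
proof -
  have d: "((\<lambda>x. damp (\<phi> x) (\<psi> x)) has_derivative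
      (\<lambda>h. (damp_ds (\<phi> x) (\<psi> x) *\<^sub>R classical_gradient \<phi> x
        + damp_dt (\<phi> x) (\<psi> x) *\<^sub>R classical_gradient \<psi> x) \<bullet> h)) (at x)" for x
    using has_derivative_damp[OF C1c_has_derivative[OF \<phi>] C1c_has_derivative[OF \<psi>]]
    by (simp add: inner_add_left)
  obtain K where K: "compact K" "K \<subseteq> \<Omega>" "\<And>x. x \<notin> K \<Longrightarrow> \<psi> x = 0" using C1c_support[OF \<psi>] by auto
  show "(\<lambda>x. damp (\<phi> x) (\<psi> x)) \<in> C1c \<Omega>"
    by (rule C1cI[OF d _ K(1,2)])
      (use K(3) in \<open>auto simp: damp_def intro!: continuous_on_add continuous_on_scaleR continuous_on_damp_ds
        continuous_on_damp_dt C1c_continuous_gradient[OF \<phi>] C1c_continuous_gradient[OF \<psi>]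
        C1c_continuous[OF \<phi>] C1c_continuous[OF \<psi>]\<close>)
  show "classical_gradient (\<lambda>x. damp (\<phi> x) (\<psi> x)) x =
      damp_ds (\<phi> x) (\<psi> x) *\<^sub>R classical_gradient \<phi> x + damp_dt (\<phi> x) (\<psi> x) *\<^sub>R classical_gradient \<psi> x"
    by (rule classical_gradient_eq[OF d])
qed

section \<open>Integration by parts for a bounded function of a test function\<close>

lemma abs_derivative_bounded_square_le: "\<bar>2 * s / (1 + s\<^sup>2)\<^sup>2\<bar> \<le> (1::real)"
proof -
  have "0 \<le> (1 - \<bar>s\<bar>)\<^sup>2" by simp
  then have "2 * \<bar>s\<bar> \<le> 1 + s\<^sup>2" by (simp add: power2_diff)
  also have "\<dots> \<le> (1 + s\<^sup>2)\<^sup>2" by (rule self_le_power) auto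
  finally show ?thesis by (simp add: abs_mult divide_le_eq add_pos_nonneg)
qed

text \<open>The partial derivative in direction \<open>i\<close> of \<open>\<eta>\<close>, the
  product of \<open>x $ i\<close> and the bounded square, has integral 0. By the product rule one
  term is the bounded square itself and the other carries its derivative
  \<open>2 * s / (1 + s\<^sup>2)\<^sup>2\<close>. The identity takes the place of a Poincare
  inequality: it recovers the size of a function from its gradient.\<close>

lemma integral_bounded_square_C1c:
  fixes \<phi> :: "real ^ 'n \<Rightarrow> real"
  assumes \<phi>: "\<phi> \<in> C1c \<Omega>" and \<Omega>: "\<Omega> \<in> sets lebesgue" "bounded \<Omega>"
  shows "(\<integral>x. (\<phi> x)\<^sup>2 / (1 + (\<phi> x)\<^sup>2) \<partial>lebesgue_on \<Omega>) =
    - (\<integral>x. 2 * \<phi> x / (1 + (\<phi> x)\<^sup>2)\<^sup>2 * ((x $ i *\<^sub>R axis i 1) \<bullet> classical_gradient \<phi> x) \<partial>lebesgue_on \<Omega>)"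
proof -
  define \<eta> where "\<eta> x = x $ i * ((\<phi> x)\<^sup>2 / (1 + (\<phi> x)\<^sup>2))" for x
  define b where "b x = (\<phi> x)\<^sup>2 / (1 + (\<phi> x)\<^sup>2)" for x
  define c where "c x = 2 * \<phi> x / (1 + (\<phi> x)\<^sup>2)\<^sup>2 * x $ i" for x
  let ?g = "\<lambda>x. b x *\<^sub>R axis i 1 + c x *\<^sub>R classical_gradient \<phi> x"
  have nz: "1 + (\<phi> x)\<^sup>2 \<noteq> 0" for x
    by (metis add_cancel_left_right one_plus_squares_nonzero power_zero_numeral add.right_neutral)
  have d: "(\<eta> has_derivative (\<lambda>h. ?g x \<bullet> h)) (at x)" for x
  proof -
    have 1: "((\<lambda>x. (\<phi> x)\<^sup>2) has_derivative (\<lambda>h. 2 * \<phi> x * (classical_gradient \<phi> x \<bullet> h))) (at x)"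
      by (auto intro!: derivative_eq_intros C1c_has_derivative[OF \<phi>])
    have 2: "((\<lambda>x. 1 + (\<phi> x)\<^sup>2) has_derivative (\<lambda>h. 2 * \<phi> x * (classical_gradient \<phi> x \<bullet> h))) (at x)"
      by (auto intro!: derivative_eq_intros C1c_has_derivative[OF \<phi>])
    have 3: "((\<lambda>x. x $ i) has_derivative (\<lambda>h. h $ i)) (at x)"
      by (rule bounded_linear_imp_has_derivative) (rule bounded_linear_vec_nth)
    have e: "(2 * \<phi> x * (classical_gradient \<phi> x \<bullet> h) * (1 + (\<phi> x)\<^sup>2) - (\<phi> x)\<^sup>2 * (2 * \<phi> x * (classical_gradient \<phi> x \<bullet> h)))
        / ((1 + (\<phi> x)\<^sup>2) * (1 + (\<phi> x)\<^sup>2)) = 2 * \<phi> x / (1 + (\<phi> x)\<^sup>2)\<^sup>2 * (classical_gradient \<phi> x \<bullet> h)" for h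
      by (simp add: power2_eq_square algebra_simps)
    show ?thesis
      using has_derivative_mult[OF 3 has_derivative_divide'[OF 1 2 nz]]
      unfolding e \<eta>_def
      by (rule has_derivative_eq_rhs) (auto simp: b_def c_def inner_add_left inner_axis' mult_ac)
  qed
  obtain K where K: "compact K" "K \<subseteq> \<Omega>" "\<And>x. x \<notin> K \<Longrightarrow> \<phi> x = 0" using C1c_support[OF \<phi>] by auto
  have cont: "continuous_on UNIV b" "continuous_on UNIV c"
    unfolding b_def c_def by (auto intro!: continuous_intros C1c_continuous[OF \<phi>] simp: nz)
  have \<eta>: "\<eta> \<in> C1c \<Omega>"
    by (rule C1cI[OF d _ K(1,2)])
      (use K(3) in \<open>auto simp: \<eta>_def intro!: continuous_intros C1c_continuous_gradient[OF \<phi>] cont\<close>)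
  have z: "\<And>x. x \<notin> K \<Longrightarrow> b x = 0" "\<And>x. x \<notin> K \<Longrightarrow> c x = 0" using K(3) by (auto simp: b_def c_def)
  have int: "integrable (lebesgue_on \<Omega>) f"
    if f: "continuous_on UNIV f" "\<And>x. x \<notin> K \<Longrightarrow> f x = 0" for f :: "real ^ 'n \<Rightarrow> real"
  proof -
    interpret finite_measure "lebesgue_on \<Omega>"
      by (rule finite_measure_lebesgue_on) (rule bounded_set_imp_lmeasurable[OF \<Omega>(2,1)])
    obtain C where "\<And>x. norm (f x) \<le> C" using bounded_range_if_compact_support[OF f(1) K(1) f(2)] by auto
    then show ?thesis
      by (intro integrable_const_bound[where B=C] AE_I2
          continuous_imp_measurable_on_sets_lebesgue continuous_on_subset[OF f(1)]) (use \<Omega> in auto)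
  qed
  have "0 = (\<integral>x. b x + c x * (classical_gradient \<phi> x $ i) \<partial>lebesgue_on \<Omega>)"
    using integral_partial_derivative_C1c[OF \<eta> \<Omega>(1), of i] by (simp add: classical_gradient_eq[OF d])
  also have "\<dots> = (\<integral>x. b x \<partial>lebesgue_on \<Omega>) + (\<integral>x. c x * (classical_gradient \<phi> x $ i) \<partial>lebesgue_on \<Omega>)"
    by (intro Bochner_Integration.integral_add int continuous_intros cont C1c_continuous_gradient[OF \<phi>]) (auto simp: z)
  finally show ?thesis
    by (simp add: b_def c_def inner_axis' mult.assoc)
qed

section \<open>Sobolev functions and local integrability\<close>

text \<open>Local integrability yields measurability on each compact subset; a countable exhaustion
  of \<open>\<Omega>\<close> by compact sets glues these together.\<close>

lemma L1_loc_measurable: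
  assumes "open \<Omega>" and u: "u \<in> L1_loc \<Omega>"
  shows "u \<in> borel_measurable (lebesgue_on \<Omega>)"
proof -
  obtain C :: "nat \<Rightarrow> _" where C: "\<Union> (range C) = \<Omega>" "\<And>n. compact (C n)" "\<And>n. C n \<subseteq> \<Omega>"
    by (rule open_Union_compact_subsets[OF assms(1)]) (rule that)
  have \<Omega>: "\<Omega> \<in> sets lebesgue" using assms(1) by (simp add: borel_open)
  have Cs: "C n \<in> sets lebesgue" for n using C(2) by (simp add: borel_compact)
  show ?thesis
  proof (rule measurable_piecewise_restrict[of "range C"])
    show "S \<inter> space (lebesgue_on \<Omega>) \<in> sets (lebesgue_on \<Omega>)" if "S \<in> range C" for S
      using that Cs C(3) \<Omega> by (auto simp: sets_restrict_space_iff Int_absorb2)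
    show "u \<in> borel_measurable (restrict_space (lebesgue_on \<Omega>) S)" if "S \<in> range C" for S
    proof -
      obtain n where S: "S = C n" using \<open>S \<in> range C\<close> by auto
      have "restrict_space (lebesgue_on \<Omega>) S = lebesgue_on (C n)"
        using C(3)[of n] \<Omega> Cs[of n] by (simp add: S restrict_restrict_space inf.absorb2)
      moreover have "u absolutely_integrable_on C n" using u C by (auto simp: L1_loc_def)
      ultimately show ?thesis using absolutely_integrable_imp_borel_measurable Cs by metis
    qed
  qed (use C in auto)
qed

lemma set_lebesgue_integral_eq_integral_lebesgue_on:
  fixes f :: "'a::euclidean_space \<Rightarrow> 'b::euclidean_space"
  assumes "\<Omega> \<in> sets lebesgue"
  shows "(LINT x:\<Omega>|lebesgue. f x) = (\<integral>x. f x \<partial>lebesgue_on \<Omega>)"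
  using assms by (simp add: set_lebesgue_integral_def integral_restrict_space)

lemma C1c_L2:
  fixes \<phi> :: "real ^ 'n \<Rightarrow> real"
  assumes \<Omega>: "open \<Omega>" "bounded \<Omega>" and \<phi>: "\<phi> \<in> C1c \<Omega>"
  shows "\<phi> \<in> borel_measurable (lebesgue_on \<Omega>)"
    and "classical_gradient \<phi> \<in> borel_measurable (lebesgue_on \<Omega>)"
    and "integrable (lebesgue_on \<Omega>) (\<lambda>x. (\<phi> x)\<^sup>2)"
    and "integrable (lebesgue_on \<Omega>) (\<lambda>x. (norm (classical_gradient \<phi> x))\<^sup>2)"
proof -
  have \<Omega>s: "\<Omega> \<in> sets lebesgue" using \<Omega>(1) by (simp add: borel_open)
  interpret finite_measure "lebesgue_on \<Omega>"
    by (rule finite_measure_lebesgue_on) (rule bounded_set_imp_lmeasurable[OF \<Omega>(2) \<Omega>s])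
  obtain K where K: "compact K" "\<And>x. x \<notin> K \<Longrightarrow> \<phi> x = 0" "\<And>x. x \<notin> K \<Longrightarrow> classical_gradient \<phi> x = 0"
    using C1c_support[OF \<phi>] by auto
  obtain C where C: "\<And>x. norm (\<phi> x) \<le> C"
    using bounded_range_if_compact_support[OF C1c_continuous[OF \<phi>] K(1,2)] by auto
  obtain C' where C': "\<And>x. norm (classical_gradient \<phi> x) \<le> C'"
    using bounded_range_if_compact_support[OF C1c_continuous_gradient[OF \<phi>] K(1,3)] by auto
  show m: "\<phi> \<in> borel_measurable (lebesgue_on \<Omega>)"
    by (rule continuous_imp_measurable_on_sets_lebesgue[OF continuous_on_subset[OF C1c_continuous[OF \<phi>]] \<Omega>s]) simp
  show m': "classical_gradient \<phi> \<in> borel_measurable (lebesgue_on \<Omega>)"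
    by (rule continuous_imp_measurable_on_sets_lebesgue[OF continuous_on_subset[OF C1c_continuous_gradient[OF \<phi>]] \<Omega>s]) simp
  show "integrable (lebesgue_on \<Omega>) (\<lambda>x. (\<phi> x)\<^sup>2)"
    using integrable_power2_norm_bounded[OF m C] by simp
  show "integrable (lebesgue_on \<Omega>) (\<lambda>x. (norm (classical_gradient \<phi> x))\<^sup>2)"
    by (rule integrable_power2_norm_bounded[OF m' C'])
qed

text \<open>Separates the single Sobolev limit into one for the functions and one for the gradients:
  both integrals are nonnegative and their sum tends to 0.\<close>

lemma H1_0_approx:
  fixes \<Omega> :: "(real ^ 'n) set"
  assumes \<Omega>: "open \<Omega>" "bounded \<Omega>" and u: "u \<in> H1_0 \<Omega>"
  defines "M \<equiv> lebesgue_on \<Omega>"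
  shows "u \<in> borel_measurable M" "weak_gradient \<Omega> u \<in> borel_measurable M"
    "integrable M (\<lambda>x. (u x)\<^sup>2)" "integrable M (\<lambda>x. (norm (weak_gradient \<Omega> u x))\<^sup>2)"
    "\<exists>\<phi>. (\<forall>n. \<phi> n \<in> C1c \<Omega>) \<and> (\<lambda>n. \<integral>x. (u x - \<phi> n x)\<^sup>2 \<partial>M) \<longlonglongrightarrow> 0 \<and>
      (\<lambda>n. \<integral>x. (norm (weak_gradient \<Omega> u x - classical_gradient (\<phi> n) x))\<^sup>2 \<partial>M) \<longlonglongrightarrow> 0"
proof -
  have \<Omega>s: "\<Omega> \<in> sets lebesgue" using \<Omega>(1) by (simp add: borel_open)
  let ?g = "weak_gradient \<Omega> u"
  \<comment> \<open>Once some weak gradient exists, the selected representative is one, and local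
    integrability makes it measurable.\<close>
  have "\<exists>g. has_weak_gradient \<Omega> u g" using u by (auto simp: W1p_0_def W1p_def W11_loc_def)
  then have "has_weak_gradient \<Omega> u ?g" unfolding weak_gradient_def by (rule someI_ex)
  then have "u \<in> L1_loc \<Omega>" "?g \<in> L1_loc \<Omega>" by (auto simp: has_weak_gradient_def)
  then show mu: "u \<in> borel_measurable M" and mg: "?g \<in> borel_measurable M"
    unfolding M_def using L1_loc_measurable[OF \<Omega>(1)] by auto
  have "(\<lambda>x. \<bar>u x\<bar> powr 2) absolutely_integrable_on \<Omega>" "(\<lambda>x. norm (?g x) powr 2) absolutely_integrable_on \<Omega>"
    using u by (auto simp: W1p_0_def W1p_def)
  then show u2: "integrable M (\<lambda>x. (u x)\<^sup>2)" and g2: "integrable M (\<lambda>x. (norm (?g x))\<^sup>2)"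
    unfolding absolutely_integrable_measurable[OF \<Omega>s] M_def by (simp_all add: o_def)
  obtain \<phi> where \<phi>: "\<And>n. \<phi> n \<in> C1c \<Omega>" and
    lim: "(\<lambda>n. LINT x:\<Omega>|lebesgue. \<bar>u x - \<phi> n x\<bar> powr 2 + norm (?g x - classical_gradient (\<phi> n) x) powr 2) \<longlonglongrightarrow> 0"
    using u by (auto simp: W1p_0_def)
  note L2 = C1c_L2[OF \<Omega> \<phi>, folded M_def]
  have i1: "integrable M (\<lambda>x. (u x - \<phi> n x)\<^sup>2)" for n
    using integrable_power2_norm_diff(1)[OF mu L2(1)] u2 L2(3) by simp
  have i2: "integrable M (\<lambda>x. (norm (?g x - classical_gradient (\<phi> n) x))\<^sup>2)" for n
    by (rule integrable_power2_norm_diff(1)[OF mg L2(2) g2 L2(4)])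
  \<comment> \<open>Splitting the integral of the sum rests on \<open>i1\<close> and
    \<open>i2\<close>, since a Bochner integral has the default value 0 when its integrand is not
    integrable.\<close>
  have lim': "(\<lambda>n. (\<integral>x. (u x - \<phi> n x)\<^sup>2 \<partial>M) + (\<integral>x. (norm (?g x - classical_gradient (\<phi> n) x))\<^sup>2 \<partial>M)) \<longlonglongrightarrow> 0"
    using lim by (simp add: set_lebesgue_integral_eq_integral_lebesgue_on[OF \<Omega>s] i1 i2 flip: M_def)
  have "(\<lambda>n. \<integral>x. (u x - \<phi> n x)\<^sup>2 \<partial>M) \<longlonglongrightarrow> 0"
    by (rule tendsto_sandwich[OF _ _ tendsto_const lim']) auto
  moreover have "(\<lambda>n. \<integral>x. (norm (?g x - classical_gradient (\<phi> n) x))\<^sup>2 \<partial>M) \<longlonglongrightarrow> 0"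
    by (rule tendsto_sandwich[OF _ _ tendsto_const lim']) auto
  ultimately show "\<exists>\<phi>. (\<forall>n. \<phi> n \<in> C1c \<Omega>) \<and> (\<lambda>n. \<integral>x. (u x - \<phi> n x)\<^sup>2 \<partial>M) \<longlonglongrightarrow> 0 \<and>
      (\<lambda>n. \<integral>x. (norm (?g x - classical_gradient (\<phi> n) x))\<^sup>2 \<partial>M) \<longlonglongrightarrow> 0"
    using \<phi> by blast
qed

text \<open>Passes from the extended product to a real integrand. Finiteness almost everywhere holds
  on each set of a countable compact exhaustion, hence on \<open>\<Omega>\<close>.\<close>

lemma L1_loc_ennreal_integrable:
  fixes \<Omega> :: "(real ^ 'n) set"
  assumes \<Omega>: "open \<Omega>" and F: "F \<in> L1_loc_ennreal \<Omega>"
  defines "M \<equiv> lebesgue_on \<Omega>"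
  shows "F \<in> borel_measurable M"
    and "\<And>K. compact K \<Longrightarrow> K \<subseteq> \<Omega> \<Longrightarrow> integrable M (\<lambda>x. indicator K x * enn2real (F x))"
    and "AE x in M. F x < \<infinity>"
proof -
  have \<Omega>s: "\<Omega> \<in> sets lebesgue" using \<Omega>(1) by (simp add: borel_open)
  show m[measurable]: "F \<in> borel_measurable M" using F by (simp add: L1_loc_ennreal_def M_def)
  have K[measurable]: "K \<in> sets M" if "compact K" "K \<subseteq> \<Omega>" for K
    using that \<Omega>s by (simp add: M_def sets_restrict_space_iff borel_compact)
  have fin: "(\<integral>\<^sup>+x. F x * indicator K x \<partial>M) < \<infinity>" if K: "compact K" "K \<subseteq> \<Omega>" for K
  proof -
    have "(\<integral>\<^sup>+x. F x * indicator K x \<partial>M) = (\<integral>\<^sup>+x. F x * indicator K x * indicator \<Omega> x \<partial>lebesgue)"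
      unfolding M_def using \<Omega>s by (subst nn_integral_restrict_space) auto
    also have "\<dots> = (\<integral>\<^sup>+x\<in>K. F x \<partial>lebesgue)"
      using K(2) by (intro nn_integral_cong) (auto simp: indicator_def)
    finally show ?thesis using F K by (simp add: L1_loc_ennreal_def)
  qed
  show "integrable M (\<lambda>x. indicator K x * enn2real (F x))" if C: "compact K" "K \<subseteq> \<Omega>" for K
  proof (rule integrableI_bounded)
    note K[OF C, measurable]
    show "(\<lambda>x. indicator K x * enn2real (F x)) \<in> borel_measurable M" by measurable
    have "ennreal (norm (indicator K x * enn2real (F x))) \<le> F x * indicator K x" for x
      by (cases "F x") (auto simp: indicator_def)
    then have "(\<integral>\<^sup>+x. ennreal (norm (indicator K x * enn2real (F x))) \<partial>M) \<le> (\<integral>\<^sup>+x. F x * indicator K x \<partial>M)"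
      by (intro nn_integral_mono)
    then show "(\<integral>\<^sup>+x. ennreal (norm (indicator K x * enn2real (F x))) \<partial>M) < \<infinity>"
      using fin[OF C] by (rule order_le_less_trans)
  qed
  obtain C :: "nat \<Rightarrow> _" where C: "\<Union> (range C) = \<Omega>" "\<And>n. compact (C n)" "\<And>n. C n \<subseteq> \<Omega>"
    by (rule open_Union_compact_subsets[OF \<Omega>]) (rule that)
  have "AE x in M. F x * indicator (C n) x \<noteq> \<infinity>" for n
  proof (rule nn_integral_noteq_infinite)
    note K[OF C(2,3), measurable]
    show "(\<lambda>x. F x * indicator (C n) x) \<in> borel_measurable M" by measurable
    show "(\<integral>\<^sup>+x. F x * indicator (C n) x \<partial>M) \<noteq> \<infinity>" using fin[OF C(2,3)] by (metis order_less_irrefl)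
  qed
  then have "AE x in M. \<forall>n. F x * indicator (C n) x \<noteq> \<infinity>" by (simp add: AE_all_countable)
  moreover have "AE x in M. x \<in> \<Omega>" by (rule AE_I2) (simp add: M_def)
  ultimately show "AE x in M. F x < \<infinity>"
  proof eventually_elim
    case (elim x)
    then obtain n where "x \<in> C n" using C(1) by auto
    then show ?case using elim(1) by (auto simp: less_top dest: spec[of _ n])
  qed
qed

text \<open>\<open>norm A\<close> is the Euclidean norm of all entries, so it bounds each row. The
  crude dimension factor is harmless: the estimate only serves to show that
  \<open>A x *v g x\<close> is square integrable.\<close>

lemma norm_matrix_vector_mult_le:
  fixes A :: "real ^ 'n ^ 'm"
  shows "norm (A *v x) \<le> real CARD('m) * (norm A * norm x)"
proof -
  have "norm (A *v x) \<le> (\<Sum>i\<in>UNIV. \<bar>(A *v x) $ i\<bar>)" by (rule norm_le_l1_cart)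
  also have "\<dots> \<le> (\<Sum>i\<in>(UNIV::'m set). norm A * norm x)"
  proof (rule sum_mono)
    fix i
    have "\<bar>(A *v x) $ i\<bar> = \<bar>A $ i \<bullet> x\<bar>" by (simp add: matrix_vector_mult_def inner_vec_def)
    also have "\<dots> \<le> norm (A $ i) * norm x" by (rule Cauchy_Schwarz_ineq2)
    also have "\<dots> \<le> norm A * norm x" by (intro mult_right_mono Finite_Cartesian_Product.norm_nth_le norm_ge_zero)
    finally show "\<bar>(A *v x) $ i\<bar> \<le> norm A * norm x" .
  qed
  finally show ?thesis by simp
qed

lemma measurable_matrix_vector_mult:
  fixes A :: "'a \<Rightarrow> real ^ 'n ^ 'm"
  assumes "A \<in> borel_measurable M" "g \<in> borel_measurable M"
  shows "(\<lambda>x. A x *v g x) \<in> borel_measurable M"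
  by (rule borel_measurable_continuous_Pair[OF assms])
    (unfold matrix_vector_mult_def, intro continuous_intros)

section \<open>The comparison argument\<close>

lemma AE_eq_0_if_integral_le_0:
  fixes b :: "'a \<Rightarrow> real"
  assumes "integrable M b" "AE x in M. 0 \<le> b x" "(\<integral>x. b x \<partial>M) \<le> 0"
  shows "AE x in M. b x = 0"
proof -
  have "(\<integral>x. b x \<partial>M) = 0" using assms(2,3) integral_nonneg_AE[of b M] by auto
  then show ?thesis using integral_nonneg_eq_0_iff_AE[OF assms(1,2)] by simp
qed

text \<open>In the application \<open>W\<close> is the matrix field applied to \<open>G\<close>, and
  \<open>F\<close> is the difference of the two right-hand sides. The functions \<open>w\<close> and
  \<open>G\<close> are tied together only by the common sequence \<open>p\<close>, whose members
  converge to \<open>w\<close> and whose gradients converge to \<open>G\<close>.\<close>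

lemma comparison_principle:
  fixes \<Omega> :: "(real ^ 'n) set" and G W :: "real ^ 'n \<Rightarrow> real ^ 'n" and p :: "nat \<Rightarrow> real ^ 'n \<Rightarrow> real"
  defines "M \<equiv> lebesgue_on \<Omega>"
  assumes \<Omega>: "open \<Omega>" "bounded \<Omega>" and \<alpha>: "\<alpha> > 0"
    and m[measurable]: "w \<in> borel_measurable M" "G \<in> borel_measurable M" "W \<in> borel_measurable M"
      "F \<in> borel_measurable M"
    and G: "integrable M (\<lambda>x. (norm (G x))\<^sup>2)" and W: "integrable M (\<lambda>x. (norm (W x))\<^sup>2)"
    and p: "\<And>n. p n \<in> C1c \<Omega>"
    and pG: "(\<lambda>n. \<integral>x. (norm (G x - classical_gradient (p n) x))\<^sup>2 \<partial>M) \<longlonglongrightarrow> 0"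
    and pw: "AE x in M. (\<lambda>n. p n x) \<longlonglongrightarrow> w x"
    and elliptic: "AE x in M. \<alpha> * (norm (G x))\<^sup>2 \<le> W x \<bullet> G x"
    and F: "\<And>K. compact K \<Longrightarrow> K \<subseteq> \<Omega> \<Longrightarrow> integrable M (\<lambda>x. indicator K x * F x)"
    and Fw: "AE x in M. F x * w x \<le> 0"
    and eq: "\<And>\<phi>. \<phi> \<in> C1c \<Omega> \<Longrightarrow> (\<integral>x. W x \<bullet> classical_gradient \<phi> x \<partial>M) = (\<integral>x. F x * \<phi> x \<partial>M)"
  shows "AE x in M. w x = 0"
proof -
  have \<Omega>s: "\<Omega> \<in> sets lebesgue" using \<Omega>(1) by (simp add: lmeasurable_iff_integrable_on borel_open)
  interpret finite_measure M
    unfolding M_def by (rule finite_measure_lebesgue_on) (rule bounded_set_imp_lmeasurable[OF \<Omega>(2) \<Omega>s])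
  have mc: "f \<in> borel_measurable M" if "continuous_on UNIV f" for f :: "real ^ 'n \<Rightarrow> 'b::euclidean_space"
    unfolding M_def by (rule continuous_imp_measurable_on_sets_lebesgue[OF continuous_on_subset[OF that] \<Omega>s]) simp
  note m\<phi>[measurable] = C1c_L2(1,2)[OF \<Omega>, folded M_def]
  note mp[measurable] = m\<phi>[OF p]
  note gL2 = C1c_L2(4)[OF \<Omega>, folded M_def]
  \<comment> \<open>The result of testing with \<open>damp (p n x) (\<psi> x)\<close> and letting
    \<open>n\<close> tend to infinity for fixed \<open>\<psi>\<close>; the term with
    \<open>F\<close> is nonpositive in the limit and disappears.\<close>
  have test: "(\<integral>x. damp_ds (w x) (\<psi> x) * (W x \<bullet> G x) \<partial>M)
      + (\<integral>x. damp_dt (w x) (\<psi> x) * (W x \<bullet> classical_gradient \<psi> x) \<partial>M) \<le> 0"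
    if \<psi>: "\<psi> \<in> C1c \<Omega>" for \<psi>
  proof -
    note m\<phi>[OF \<psi>, measurable]
    obtain K where K: "compact K" "K \<subseteq> \<Omega>" "\<And>x. x \<notin> K \<Longrightarrow> \<psi> x = 0" using C1c_support[OF \<psi>] by auto
    obtain C where C: "\<And>x. norm (\<psi> x) \<le> C"
      using bounded_range_if_compact_support[OF C1c_continuous[OF \<psi>] K(1,3)] by auto
    have 1: "(\<lambda>n. \<integral>x. damp_ds (p n x) (\<psi> x) * (W x \<bullet> classical_gradient (p n) x) \<partial>M)
        \<longlonglongrightarrow> (\<integral>x. damp_ds (w x) (\<psi> x) * (W x \<bullet> G x) \<partial>M)"
    proof (rule tendsto_integral_mult_inner_L2[where C=1])
      show "AE x in M. (\<lambda>n. damp_ds (p n x) (\<psi> x)) \<longlonglongrightarrow> damp_ds (w x) (\<psi> x)"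
        using pw by eventually_elim (intro tendsto_damp_ds tendsto_const)
    qed (use W G gL2[OF p] pG abs_damp_ds_le in measurable)
    have 2: "(\<lambda>n. \<integral>x. damp_dt (p n x) (\<psi> x) * (W x \<bullet> classical_gradient \<psi> x) \<partial>M)
        \<longlonglongrightarrow> (\<integral>x. damp_dt (w x) (\<psi> x) * (W x \<bullet> classical_gradient \<psi> x) \<partial>M)"
    proof (rule tendsto_integral_mult_inner_L2[where C=1])
      show "AE x in M. (\<lambda>n. damp_dt (p n x) (\<psi> x)) \<longlonglongrightarrow> damp_dt (w x) (\<psi> x)"
        using pw by eventually_elim (intro tendsto_damp_dt tendsto_const)
      show "(\<lambda>n. \<integral>x. (norm (classical_gradient \<psi> x - classical_gradient \<psi> x))\<^sup>2 \<partial>M) \<longlonglongrightarrow> 0" by simp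
    qed (use W gL2[OF \<psi>] abs_damp_dt_le in measurable)
    \<comment> \<open>Here \<open>\<psi>\<close> has to stay fixed: its support \<open>K\<close> and
      its bound \<open>C\<close> give a majorant uniform in \<open>n\<close>, although
      \<open>F\<close> is integrable only over compact subsets of \<open>\<Omega>\<close>.\<close>
    have 3: "(\<lambda>n. \<integral>x. F x * damp (p n x) (\<psi> x) \<partial>M) \<longlonglongrightarrow> (\<integral>x. F x * damp (w x) (\<psi> x) \<partial>M)"
    proof (rule integral_dominated_convergence[where w="\<lambda>x. C\<^sup>2 * \<bar>indicator K x * F x\<bar>"])
      show "integrable M (\<lambda>x. C\<^sup>2 * \<bar>indicator K x * F x\<bar>)"
        by (intro integrable_mult_right integrable_abs F K)
      show "AE x in M. (\<lambda>n. F x * damp (p n x) (\<psi> x)) \<longlonglongrightarrow> F x * damp (w x) (\<psi> x)"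
        using pw by eventually_elim (intro tendsto_mult tendsto_damp tendsto_const)
      have "norm (F x * damp (p n x) (\<psi> x)) \<le> C\<^sup>2 * \<bar>indicator K x * F x\<bar>" for n x
      proof (cases "x \<in> K")
        case True
        have "\<bar>damp (p n x) (\<psi> x)\<bar> \<le> (\<psi> x)\<^sup>2" by (rule abs_damp_le)
        also have "\<dots> \<le> C\<^sup>2" using C[of x] by (intro abs_le_square_iff[THEN iffD1]) simp
        finally show ?thesis using True by (simp add: abs_mult mult.commute[of "C\<^sup>2"] mult_left_mono)
      qed (use K(3) in \<open>simp add: damp_def\<close>)
      then show "AE x in M. norm (F x * damp (p n x) (\<psi> x)) \<le> C\<^sup>2 * \<bar>indicator K x * F x\<bar>" for n
        by simp
    qed measurable
    have "(\<integral>x. damp_ds (p n x) (\<psi> x) * (W x \<bullet> classical_gradient (p n) x) \<partial>M)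
        + (\<integral>x. damp_dt (p n x) (\<psi> x) * (W x \<bullet> classical_gradient \<psi> x) \<partial>M)
        = (\<integral>x. F x * damp (p n x) (\<psi> x) \<partial>M)" for n
    proof -
      have "(\<integral>x. F x * damp (p n x) (\<psi> x) \<partial>M)
        = (\<integral>x. damp_ds (p n x) (\<psi> x) * (W x \<bullet> classical_gradient (p n) x)
            + damp_dt (p n x) (\<psi> x) * (W x \<bullet> classical_gradient \<psi> x) \<partial>M)"
        using eq[OF C1c_damp(1)[OF p \<psi>]] by (simp add: C1c_damp(2)[OF p \<psi>] inner_add_right)
      also have "\<dots> = (\<integral>x. damp_ds (p n x) (\<psi> x) * (W x \<bullet> classical_gradient (p n) x) \<partial>M)
        + (\<integral>x. damp_dt (p n x) (\<psi> x) * (W x \<bullet> classical_gradient \<psi> x) \<partial>M)"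
        by (intro Bochner_Integration.integral_add integrable_inner_L2[where C=1])
          (use W gL2[OF p] gL2[OF \<psi>] abs_damp_ds_le abs_damp_dt_le p in auto)
      finally show ?thesis by simp
    qed
    then have "(\<integral>x. damp_ds (w x) (\<psi> x) * (W x \<bullet> G x) \<partial>M)
      + (\<integral>x. damp_dt (w x) (\<psi> x) * (W x \<bullet> classical_gradient \<psi> x) \<partial>M)
      = (\<integral>x. F x * damp (w x) (\<psi> x) \<partial>M)"
      using LIMSEQ_unique[OF tendsto_add[OF 1 2]] 3 by simp
    also have "\<dots> \<le> 0"
    proof -
      have "AE x in M. 0 \<le> - (F x * damp (w x) (\<psi> x))"
        using Fw by eventually_elim (simp add: mult_damp_nonpos)
      from integral_nonneg_AE[OF this] show ?thesis by simp
    qed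
    finally show ?thesis .
  qed
  have intQ: "integrable M (\<lambda>x. damp_ds (w x) (w x) * (W x \<bullet> G x))"
      "integrable M (\<lambda>x. damp_dt (w x) (w x) * (W x \<bullet> G x))"
    by (intro integrable_inner_L2[where C=1]; use W G abs_damp_ds_le abs_damp_dt_le in auto)+
  \<comment> \<open>As \<open>F\<close> no longer occurs in \<open>test\<close>, the second argument
    may now run through \<open>p n\<close>, whose supports need not stay in one compact subset of
    \<open>\<Omega>\<close>.\<close>
  have "(\<lambda>n. (\<integral>x. damp_ds (w x) (p n x) * (W x \<bullet> G x) \<partial>M)
      + (\<integral>x. damp_dt (w x) (p n x) * (W x \<bullet> classical_gradient (p n) x) \<partial>M))
    \<longlonglongrightarrow> (\<integral>x. damp_ds (w x) (w x) * (W x \<bullet> G x) \<partial>M)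
      + (\<integral>x. damp_dt (w x) (w x) * (W x \<bullet> G x) \<partial>M)"
  proof (intro tendsto_add)
    show "(\<lambda>n. \<integral>x. damp_ds (w x) (p n x) * (W x \<bullet> G x) \<partial>M)
      \<longlonglongrightarrow> (\<integral>x. damp_ds (w x) (w x) * (W x \<bullet> G x) \<partial>M)"
    proof (rule tendsto_integral_mult_inner_L2[where C=1])
      show "AE x in M. (\<lambda>n. damp_ds (w x) (p n x)) \<longlonglongrightarrow> damp_ds (w x) (w x)"
        using pw by eventually_elim (intro tendsto_damp_ds tendsto_const)
      show "(\<lambda>n. \<integral>x. (norm (G x - G x))\<^sup>2 \<partial>M) \<longlonglongrightarrow> 0" by simp
    qed (use W G abs_damp_ds_le in measurable)
    show "(\<lambda>n. \<integral>x. damp_dt (w x) (p n x) * (W x \<bullet> classical_gradient (p n) x) \<partial>M)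
      \<longlonglongrightarrow> (\<integral>x. damp_dt (w x) (w x) * (W x \<bullet> G x) \<partial>M)"
    proof (rule tendsto_integral_mult_inner_L2[where C=1])
      show "AE x in M. (\<lambda>n. damp_dt (w x) (p n x)) \<longlonglongrightarrow> damp_dt (w x) (w x)"
        using pw by eventually_elim (intro tendsto_damp_dt tendsto_const)
    qed (use W G gL2[OF p] pG abs_damp_dt_le in measurable)
  qed
  then have "(\<integral>x. damp_ds (w x) (w x) * (W x \<bullet> G x) \<partial>M)
      + (\<integral>x. damp_dt (w x) (w x) * (W x \<bullet> G x) \<partial>M) \<le> 0"
    by (rule LIMSEQ_le_const2) (use test[OF p] in auto)
  then have le0: "(\<integral>x. (damp_ds (w x) (w x) + damp_dt (w x) (w x)) * (W x \<bullet> G x) \<partial>M) \<le> 0"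
    using intQ by (simp add: distrib_right)
  have WG: "AE x in M. 0 \<le> W x \<bullet> G x"
    using elliptic
  proof eventually_elim
    case (elim x)
    have "0 \<le> \<alpha> * (norm (G x))\<^sup>2" using \<alpha> by simp
    with elim show ?case by linarith
  qed
  have "AE x in M. (damp_ds (w x) (w x) + damp_dt (w x) (w x)) * (W x \<bullet> G x) = 0"
  proof (rule AE_eq_0_if_integral_le_0[OF _ _ le0])
    show "integrable M (\<lambda>x. (damp_ds (w x) (w x) + damp_dt (w x) (w x)) * (W x \<bullet> G x))"
      using Bochner_Integration.integrable_add[OF intQ] by (simp add: distrib_right)
    show "AE x in M. 0 \<le> (damp_ds (w x) (w x) + damp_dt (w x) (w x)) * (W x \<bullet> G x)"
      using WG by eventually_elim (intro mult_nonneg_nonneg damp_ds_plus_dt_nonneg)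
  qed
  with elliptic have G0: "AE x in M. w x = 0 \<or> G x = 0"
  proof eventually_elim
    case (elim x)
    show ?case
    proof (cases "w x = 0")
      case False
      then have "damp_ds (w x) (w x) + damp_dt (w x) (w x) \<noteq> 0" using damp_ds_plus_dt_eq_0 by blast
      then have "W x \<bullet> G x = 0" using elim(2) by (simp only: mult_eq_0_iff) blast
      then have "\<alpha> * (norm (G x))\<^sup>2 \<le> 0" using elim(1) by simp
      then have "(norm (G x))\<^sup>2 \<le> 0" using \<alpha> by (simp add: mult_le_0_iff)
      then show ?thesis by simp
    qed simp
  qed

  \<comment> \<open>From the vanishing of the gradient to the vanishing of the function\<close>
  let ?b = "\<lambda>s::real. s\<^sup>2 / (1 + s\<^sup>2)" and ?b' = "\<lambda>s::real. 2 * s / (1 + s\<^sup>2)\<^sup>2"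
  have nz: "1 + s\<^sup>2 \<noteq> (0::real)" for s using one_plus_squares_nonzero[of s 0] by simp
  \<comment> \<open>One arbitrary coordinate direction suffices, as the conclusion does not mention
    \<open>i\<close>.\<close>
  fix i :: 'n
  let ?V = "\<lambda>x::real ^ 'n. x $ i *\<^sub>R axis i (1::real)"
  have mV[measurable]: "?V \<in> borel_measurable M" by (intro mc continuous_intros)
  obtain R where R: "\<And>x. x \<in> \<Omega> \<Longrightarrow> norm x \<le> R" using \<Omega>(2) by (auto simp: bounded_iff)
  \<comment> \<open>On the bounded set \<open>\<Omega>\<close> the coordinate field is bounded, so
    it is an admissible square-integrable factor in the limit lemma.\<close>
  have V: "integrable M (\<lambda>x. (norm (?V x))\<^sup>2)"
  proof (rule integrable_power2_norm_bounded[OF mV])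
    show "norm (?V x) \<le> R" if "x \<in> space M" for x
      using that R[of x] component_le_norm_cart[of x i] by (simp add: M_def)
  qed
  have b1: "\<bar>?b s\<bar> \<le> 1" for s by (simp add: divide_le_eq add_pos_nonneg)
  have lim1: "(\<lambda>n. \<integral>x. ?b (p n x) \<partial>M) \<longlonglongrightarrow> (\<integral>x. ?b (w x) \<partial>M)"
  proof (rule integral_dominated_convergence[where w="\<lambda>_. 1"])
    show "AE x in M. (\<lambda>n. ?b (p n x)) \<longlonglongrightarrow> ?b (w x)"
      using pw by eventually_elim (intro tendsto_intros nz)
  qed (use b1 in auto)
  have lim2: "(\<lambda>n. \<integral>x. ?b' (p n x) * (?V x \<bullet> classical_gradient (p n) x) \<partial>M)
      \<longlonglongrightarrow> (\<integral>x. ?b' (w x) * (?V x \<bullet> G x) \<partial>M)"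
  proof (rule tendsto_integral_mult_inner_L2[where C=1])
    show "AE x in M. (\<lambda>n. ?b' (p n x)) \<longlonglongrightarrow> ?b' (w x)"
      using pw by eventually_elim (intro tendsto_intros, simp_all add: nz)
  qed (use V G gL2[OF p] pG abs_derivative_bounded_square_le in measurable)
  have "(\<integral>x. ?b (p n x) \<partial>M) = - (\<integral>x. ?b' (p n x) * (?V x \<bullet> classical_gradient (p n) x) \<partial>M)" for n
    unfolding M_def by (rule integral_bounded_square_C1c[OF p \<Omega>s \<Omega>(2)])
  then have "(\<integral>x. ?b (w x) \<partial>M) = - (\<integral>x. ?b' (w x) * (?V x \<bullet> G x) \<partial>M)"
    using LIMSEQ_unique[OF lim1] tendsto_minus[OF lim2] by (simp only:)
  \<comment> \<open>\<open>?b'\<close> vanishes at 0, which settles the points where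
    \<open>w\<close> is 0; at almost all others \<open>G\<close> is 0.\<close>
  also have "(\<integral>x. ?b' (w x) * (?V x \<bullet> G x) \<partial>M) = (\<integral>x. 0 \<partial>M)"
  proof (rule integral_cong_AE)
    show "(\<lambda>x. ?b' (w x) * (?V x \<bullet> G x)) \<in> borel_measurable M" by measurable
    show "AE x in M. ?b' (w x) * (?V x \<bullet> G x) = 0" using G0 by eventually_elim auto
  qed simp
  finally have "AE x in M. ?b (w x) = 0"
    by (intro AE_eq_0_if_integral_le_0 integrable_const_bound[where B=1]) (use b1 in auto)
  then show ?thesis by eventually_elim (simp add: nz)
qed

section \<open>Uniqueness of weak solutions\<close>

theorem theorem4p10:
  fixes \<Omega> :: "(real ^ 'n) set"
    and A :: "real ^ 'n \<Rightarrow> real ^ 'n ^ 'n"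
    and f :: "real ^ 'n \<Rightarrow> real"
    and h :: "real \<Rightarrow> ennreal"
    and \<alpha> \<beta> \<gamma> c1 s1 :: real
    and u v :: "real ^ 'n \<Rightarrow> real"
  assumes "CARD('n) \<ge> 2"
    and "open \<Omega>" and "bounded \<Omega>"
    and "A \<in> borel_measurable (lebesgue_on \<Omega>)"
    and "\<alpha> > 0" and "\<beta> > 0"
    and "AE x in lebesgue_on \<Omega>. (\<forall>\<xi>. (A x *v \<xi>) \<bullet> \<xi> \<ge> \<alpha> * (norm \<xi>)\<^sup>2) \<and> norm (A x) \<le> \<beta>"
    and "f absolutely_integrable_on \<Omega>"
    and "AE x in lebesgue_on \<Omega>. 0 \<le> f x"
    and "continuous_on {0..} h"
    and "\<And>s. s > 0 \<Longrightarrow> h s < \<infinity>"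
    and "h 0 \<noteq> 0"
    and "\<gamma> \<ge> 0" and "c1 > 0" and "s1 > 0"
    and "\<And>s. 0 < s \<Longrightarrow> s < s1 \<Longrightarrow> h s \<le> ennreal (c1 * s powr (- \<gamma>))"
    and "Limsup at_top h < \<infinity>"
    and "antimono_on {0..} h"
    and "weak_solution \<Omega> A h \<gamma> f u"
    and "weak_solution \<Omega> A h \<gamma> f v"
  shows "AE x in lebesgue_on \<Omega>. u x = v x"
proof -
  define M where "M = lebesgue_on \<Omega>"
  note \<Omega> = assms(2,3)
  have \<Omega>s: "\<Omega> \<in> sets lebesgue" using \<Omega>(1) by (simp add: borel_open)
  note LINT = set_lebesgue_integral_eq_integral_lebesgue_on[OF \<Omega>s, folded M_def]
  have mA[measurable]: "A \<in> borel_measurable M" using assms(4) by (simp add: M_def)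
  have ellA: "AE x in M. (\<forall>\<xi>. \<alpha> * (norm \<xi>)\<^sup>2 \<le> (A x *v \<xi>) \<bullet> \<xi>) \<and> norm (A x) \<le> \<beta>"
    using assms(7) unfolding M_def .
  have du: "distributional_solution \<Omega> A h \<gamma> f u" and hu: "u \<in> H1_0 \<Omega>"
    and dv: "distributional_solution \<Omega> A h \<gamma> f v" and hv: "v \<in> H1_0 \<Omega>"
    using assms(19,20) by (auto simp: weak_solution_def)
  define a where "a = weak_gradient \<Omega> u"
  define c where "c = weak_gradient \<Omega> v"
  define Hu where "Hu x = h (u x) * ennreal (f x)" for x
  define Hv where "Hv x = h (v x) * ennreal (f x)" for x
  have u0: "AE x in M. 0 \<le> u x" and Hu: "Hu \<in> L1_loc_ennreal \<Omega>"
    and equ: "\<And>\<phi>. \<phi> \<in> C1c \<Omega> \<Longrightarrow>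
      (\<integral>x. (A x *v a x) \<bullet> classical_gradient \<phi> x \<partial>M) = (\<integral>x. enn2real (Hu x) * \<phi> x \<partial>M)"
    using du unfolding distributional_solution_def LINT a_def[symmetric] Hu_def[symmetric] M_def[symmetric]
    by (auto simp: Hu_def[abs_def])
  have v0: "AE x in M. 0 \<le> v x" and Hv: "Hv \<in> L1_loc_ennreal \<Omega>"
    and eqv: "\<And>\<phi>. \<phi> \<in> C1c \<Omega> \<Longrightarrow>
      (\<integral>x. (A x *v c x) \<bullet> classical_gradient \<phi> x \<partial>M) = (\<integral>x. enn2real (Hv x) * \<phi> x \<partial>M)"
    using dv unfolding distributional_solution_def LINT c_def[symmetric] Hv_def[symmetric] M_def[symmetric]
    by (auto simp: Hv_def[abs_def])
  note U = H1_0_approx[OF \<Omega> hu, folded M_def a_def]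
  note V = H1_0_approx[OF \<Omega> hv, folded M_def c_def]
  note [measurable] = U(1,2) V(1,2)
  note HU = L1_loc_ennreal_integrable[OF \<Omega>(1) Hu, folded M_def]
  note HV = L1_loc_ennreal_integrable[OF \<Omega>(1) Hv, folded M_def]
  note [measurable] = HU(1) HV(1)
  note L2 = C1c_L2[OF \<Omega>, folded M_def]
  obtain \<phi> where \<phi>: "\<And>n. \<phi> n \<in> C1c \<Omega>" "(\<lambda>n. \<integral>x. (u x - \<phi> n x)\<^sup>2 \<partial>M) \<longlonglongrightarrow> 0"
    "(\<lambda>n. \<integral>x. (norm (a x - classical_gradient (\<phi> n) x))\<^sup>2 \<partial>M) \<longlonglongrightarrow> 0"
    using U(5) by auto
  obtain \<psi> where \<psi>: "\<And>n. \<psi> n \<in> C1c \<Omega>" "(\<lambda>n. \<integral>x. (v x - \<psi> n x)\<^sup>2 \<partial>M) \<longlonglongrightarrow> 0"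
    "(\<lambda>n. \<integral>x. (norm (c x - classical_gradient (\<psi> n) x))\<^sup>2 \<partial>M) \<longlonglongrightarrow> 0"
    using V(5) by auto
  note [measurable] = L2(1,2)[OF \<phi>(1)] L2(1,2)[OF \<psi>(1)]
  define w where "w x = u x - v x" for x
  define G where "G x = a x - c x" for x
  define q where "q n x = \<phi> n x - \<psi> n x" for n x
  have q: "q n \<in> C1c \<Omega>" and gq: "classical_gradient (q n) x = classical_gradient (\<phi> n) x - classical_gradient (\<psi> n) x" for n x
    unfolding q_def by (rule C1c_diff[OF \<phi>(1) \<psi>(1)])+
  note [measurable] = L2(1,2)[OF q]
  have mw[measurable]: "w \<in> borel_measurable M" and mG[measurable]: "G \<in> borel_measurable M"
    unfolding w_def G_def by measurable
  have iu: "integrable M (\<lambda>x. (norm (u x - \<phi> n x))\<^sup>2)" for n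
    by (rule integrable_power2_norm_diff) (use U(3) L2(3)[OF \<phi>(1)] in auto)
  have iv: "integrable M (\<lambda>x. (norm (v x - \<psi> n x))\<^sup>2)" for n
    by (rule integrable_power2_norm_diff) (use V(3) L2(3)[OF \<psi>(1)] in auto)
  have ia: "integrable M (\<lambda>x. (norm (a x - classical_gradient (\<phi> n) x))\<^sup>2)" for n
    by (rule integrable_power2_norm_diff) (use U(4) L2(4)[OF \<phi>(1)] in auto)
  have ic: "integrable M (\<lambda>x. (norm (c x - classical_gradient (\<psi> n) x))\<^sup>2)" for n
    by (rule integrable_power2_norm_diff) (use V(4) L2(4)[OF \<psi>(1)] in auto)
  have qG: "(\<lambda>n. \<integral>x. (norm (G x - classical_gradient (q n) x))\<^sup>2 \<partial>M) \<longlonglongrightarrow> 0"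
  proof -
    have "(\<lambda>n. \<integral>x. (norm ((a x - classical_gradient (\<phi> n) x) - (c x - classical_gradient (\<psi> n) x)))\<^sup>2 \<partial>M) \<longlonglongrightarrow> 0"
      by (rule tendsto_L2_diff) (use ia ic \<phi>(3) \<psi>(3) in auto)
    then show ?thesis by (simp add: G_def gq algebra_simps)
  qed
  have iw: "integrable M (\<lambda>x. (norm (w x - q n x))\<^sup>2)" for n
    using integrable_power2_norm_diff(1)[OF _ _ iu iv, of n n] by (simp add: w_def q_def algebra_simps)
  have "(\<lambda>n. \<integral>x. (norm (w x - q n x))\<^sup>2 \<partial>M) \<longlonglongrightarrow> 0"
  proof -
    have "(\<lambda>n. \<integral>x. (norm ((u x - \<phi> n x) - (v x - \<psi> n x)))\<^sup>2 \<partial>M) \<longlonglongrightarrow> 0"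
      by (rule tendsto_L2_diff) (use iu iv \<phi>(2) \<psi>(2) in auto)
    then show ?thesis by (simp add: w_def q_def algebra_simps)
  qed
  \<comment> \<open>Mean-square convergence gives convergence almost everywhere only along a
    subsequence; the convergence of the gradients is inherited by it.\<close>
  then have "\<exists>r. strict_mono r \<and> (AE x in M. (\<lambda>n. (norm (w x - q (r n) x))\<^sup>2) \<longlonglongrightarrow> 0)"
    using tendsto_L1_AE_subseq[OF iw] by simp
  then obtain r :: "nat \<Rightarrow> nat" where r: "strict_mono r" "AE x in M. (\<lambda>n. (norm (w x - q (r n) x))\<^sup>2) \<longlonglongrightarrow> 0"
    by auto
  have qw: "AE x in M. (\<lambda>n. q (r n) x) \<longlonglongrightarrow> w x"
    using r(2)
  proof eventually_elim
    case (elim x)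
    have "(\<lambda>n. norm (w x - q (r n) x)) \<longlonglongrightarrow> 0"
      using tendsto_real_sqrt[OF elim] by simp
    then have "(\<lambda>n. w x - (w x - q (r n) x)) \<longlonglongrightarrow> w x - 0"
      by (intro tendsto_diff tendsto_const) (rule tendsto_norm_zero_cancel)
    then show ?case by simp
  qed
  have mAg[measurable]: "(\<lambda>x. A x *v g x) \<in> borel_measurable M" if "g \<in> borel_measurable M" for g :: "real ^ 'n \<Rightarrow> real ^ 'n"
    using that by (intro measurable_matrix_vector_mult mA)
  have Ag: "integrable M (\<lambda>x. (norm (A x *v g x))\<^sup>2)"
    if [measurable]: "g \<in> borel_measurable M" and g: "integrable M (\<lambda>x. (norm (g x))\<^sup>2)" for g
  proof (rule Bochner_Integration.integrable_bound)
    let ?C = "real CARD('n) * \<beta>"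
    show "integrable M (\<lambda>x. ?C\<^sup>2 * (norm (g x))\<^sup>2)" using g by simp
    show "(\<lambda>x. (norm (A x *v g x))\<^sup>2) \<in> borel_measurable M"
      using mAg[OF that(1)] by measurable
    show "AE x in M. norm ((norm (A x *v g x))\<^sup>2) \<le> norm (?C\<^sup>2 * (norm (g x))\<^sup>2)"
      using ellA
    proof eventually_elim
      case (elim x)
      have "norm (A x *v g x) \<le> real CARD('n) * (norm (A x) * norm (g x))"
        by (rule norm_matrix_vector_mult_le)
      also have "\<dots> \<le> real CARD('n) * (\<beta> * norm (g x))"
        using elim by (intro mult_left_mono mult_right_mono) auto
      finally have "(norm (A x *v g x))\<^sup>2 \<le> (?C * norm (g x))\<^sup>2" by (intro power_mono) (simp_all add: mult.assoc)
      then show ?case by (simp add: power_mult_distrib)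
    qed
  qed
  have iG: "integrable M (\<lambda>x. (norm (G x))\<^sup>2)"
    unfolding G_def by (rule integrable_power2_norm_diff) (use U V in auto)
  \<comment> \<open>The difference is formed after the passage to the reals, because subtraction in
    \<open>ennreal\<close> is truncated at 0 and would lose the sign.\<close>
  define F where "F x = enn2real (Hu x) - enn2real (Hv x)" for x
  have "AE x in M. w x = 0"
  proof (rule comparison_principle[OF \<Omega> assms(5), where G=G and W="\<lambda>x. A x *v G x" and F=F and p="\<lambda>n. q (r n)",
        folded M_def])
    show "(\<lambda>x. A x *v G x) \<in> borel_measurable M" by (rule mAg[OF mG])
    show "F \<in> borel_measurable M" unfolding F_def by measurable
    show "integrable M (\<lambda>x. (norm (A x *v G x))\<^sup>2)" by (rule Ag[OF mG iG])
    show "(\<lambda>n. \<integral>x. (norm (G x - classical_gradient (q (r n)) x))\<^sup>2 \<partial>M) \<longlonglongrightarrow> 0"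
      using LIMSEQ_subseq_LIMSEQ[OF qG r(1)] by (simp add: o_def)
    show "AE x in M. \<alpha> * (norm (G x))\<^sup>2 \<le> (A x *v G x) \<bullet> G x"
      using ellA by eventually_elim auto
    show "integrable M (\<lambda>x. indicator K x * F x)" if "compact K" "K \<subseteq> \<Omega>" for K
      using Bochner_Integration.integrable_diff[OF HU(2) HV(2), OF that that] by (simp add: F_def right_diff_distrib)
    \<comment> \<open>Monotonicity of \<open>h\<close> orders \<open>Hu x\<close> and
      \<open>Hv x\<close> opposite to \<open>u x\<close> and \<open>v x\<close>. Since
      \<open>enn2real\<close> sends infinity to 0, it preserves this order only when the larger
      value is finite, which \<open>HU(3)\<close> and \<open>HV(3)\<close> provide almost
      everywhere.\<close>
    show "AE x in M. F x * w x \<le> 0"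
      using u0 v0 HU(3) HV(3)
    proof eventually_elim
      case (elim x)
      show ?case
      proof (cases "v x \<le> u x")
        case True
        then have "h (u x) \<le> h (v x)" using assms(18) elim(1,2) by (auto simp: monotone_on_def)
        then have "Hu x \<le> Hv x" unfolding Hu_def Hv_def by (rule mult_right_mono) simp
        then have "F x \<le> 0" using enn2real_mono elim(4) by (simp add: F_def)
        then show ?thesis using True by (simp add: w_def mult_nonpos_nonneg)
      next
        case False
        then have "h (v x) \<le> h (u x)" using assms(18) elim(1,2) by (auto simp: monotone_on_def)
        then have "Hv x \<le> Hu x" unfolding Hu_def Hv_def by (rule mult_right_mono) simp
        then have "0 \<le> F x" using enn2real_mono elim(3) by (simp add: F_def)
        then show ?thesis using False by (simp add: w_def mult_nonneg_nonpos)
      qed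
    qed
    fix \<eta> assume \<eta>: "\<eta> \<in> C1c \<Omega>"
    note [measurable] = L2(1,2)[OF \<eta>]
    obtain K where K: "compact K" "K \<subseteq> \<Omega>" "\<And>x. x \<notin> K \<Longrightarrow> \<eta> x = 0" using C1c_support[OF \<eta>] by auto
    obtain B where B: "\<And>x. norm (\<eta> x) \<le> B"
      using bounded_range_if_compact_support[OF C1c_continuous[OF \<eta>] K(1,3)] by auto
    \<comment> \<open>The right-hand sides are integrable only over compact sets; the support
      \<open>K\<close> and the bound \<open>B\<close> of the test function make each product
      integrable, so that the two equations can be subtracted.\<close>
    have iH: "integrable M (\<lambda>x. enn2real (H x) * \<eta> x)"
      if [measurable]: "H \<in> borel_measurable M" and H: "integrable M (\<lambda>x. indicator K x * enn2real (H x))" for H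
    proof (rule Bochner_Integration.integrable_bound)
      show "integrable M (\<lambda>x. (indicator K x * enn2real (H x)) * B)" using H by simp
      have "norm (enn2real (H x) * \<eta> x) \<le> norm ((indicator K x * enn2real (H x)) * B)" for x
      proof (cases "x \<in> K")
        case True
        then show ?thesis using B[of x] by (simp add: abs_mult mult_left_mono)
      qed (use K(3) in simp)
      then show "AE x in M. norm (enn2real (H x) * \<eta> x) \<le> norm ((indicator K x * enn2real (H x)) * B)" by simp
    qed measurable
    have iA: "integrable M (\<lambda>x. (A x *v g x) \<bullet> classical_gradient \<eta> x)"
      if g: "g \<in> borel_measurable M" "integrable M (\<lambda>x. (norm (g x))\<^sup>2)" for g
      using integrable_inner_L2[OF mAg[OF g(1)] L2(2)[OF \<eta>] borel_measurable_const Ag[OF g] L2(4)[OF \<eta>], of 1 1] by simp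
    have "(\<integral>x. (A x *v G x) \<bullet> classical_gradient \<eta> x \<partial>M)
      = (\<integral>x. (A x *v a x) \<bullet> classical_gradient \<eta> x - (A x *v c x) \<bullet> classical_gradient \<eta> x \<partial>M)"
      by (simp add: G_def matrix_vector_mult_diff_distrib inner_diff_left)
    also have "\<dots> = (\<integral>x. enn2real (Hu x) * \<eta> x \<partial>M) - (\<integral>x. enn2real (Hv x) * \<eta> x \<partial>M)"
      using iA U(2,4) V(2,4) by (simp add: equ[OF \<eta>] eqv[OF \<eta>])
    also have "\<dots> = (\<integral>x. F x * \<eta> x \<partial>M)"
      using iH[OF HU(1) HU(2)[OF K(1,2)]] iH[OF HV(1) HV(2)[OF K(1,2)]] by (simp add: F_def left_diff_distrib)
    finally show "(\<integral>x. (A x *v G x) \<bullet> classical_gradient \<eta> x \<partial>M) = (\<integral>x. F x * \<eta> x \<partial>M)" .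
  qed (use iG q qw in auto)
  then show ?thesis unfolding M_def by eventually_elim (simp add: w_def)
qed

end
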